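(* Let $\Sigma=(A,G,\alpha,\sigma)$ be a unital discrete twisted C$^*$-dynamical system. Then $B(\Sigma)=\mathrm{Span}\,P(\Sigma)$ (linear span over $\mathbb{C}$).
   Context: Conventions: all C$^*$-algebras are unital and homomorphisms between them are unital and $*$-preserving. $\Sigma=(A,G,\alpha,\sigma)$ is a unital discrete twisted C$^*$-dynamical system: $A$ is a C$^*$-algebra with unit $1$, $G$ is a discrete group with identity $e$, $\alpha:G\to \mathrm{Aut}(A)$ and $\sigma:G\times G\to \mathcal{U}(A)$ (the unitary group of $A$) are maps satisfying $\alpha_g\alpha_h=\mathrm{Ad}(\sigma(g,h))\,\alpha_{gh}$, $\sigma(g,h)\sigma(gh,k)=\alpha_g(\sigma(h,k))\sigma(g,hk)$ and $\sigma(g,e)=\sigma(e,g)=1$ for all $g,h,k\in G$. Hilbert $A$-modules are right modules, with $A$-valued inner product linear in the second variable; $\mathcal{L}(X)$ denotes the adjointable operators on $X$. An equivariant representation of $\Sigma$ on a Hilbert $A$-module $X$ is a pair $(\rho,v)$ where $\rho:A\to\mathcal{L}(X)$ is a (unital $*$-) homomorphism and $v:G\to\mathcal{I}(X)$ is a map into the group of $\mathbb{C}$-linear, invertible, bounded maps $X\to X$, such that for all $g,h\in G$, $a\in A$, $x,x'\in X$: (i) $\rho(\alpha_g(a))=v(g)\rho(a)v(g)^{-1}$; (ii) $v(g)v(h)=\mathrm{ad}_\rho(\sigma(g,h))\,v(gh)$, where $\mathrm{ad}_\rho(\sigma(g,h))x=(\rho(\sigma(g,h))x)\cdot\sigma(g,h)^*$;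 (iii) $\alpha_g(\langle x,x'\rangle)=\langle v(g)x,v(g)x'\rangle$; (iv) $v(g)(x\cdot a)=(v(g)x)\cdot\alpha_g(a)$. $L(\Sigma)$ is the set of all maps $T:G\times A\to A$ that are linear in the second variable; write $T_g(a)=T(g,a)$. $T_{\rho,v,x,y}\in L(\Sigma)$ is defined by $T_{\rho,v,x,y}(g,a)=\langle x,\rho(a)v(g)y\rangle$, and $B(\Sigma)$ is the set of all such maps, for some equivariant representation $(\rho,v)$ on some Hilbert $A$-module $X$ and $x,y\in X$. $T\in L(\Sigma)$ is positive definite (w.r.t. $\Sigma$) if for any $n\in\mathbb{N}$, $g_1,\dots,g_n\in G$ and $a_1,\dots,a_n\in A$, the matrix $\Big[\alpha_{g_i}\Big(T_{g_i^{-1}g_j}\big(\alpha_{g_i}^{-1}(a_i^*a_j\,\sigma(g_i,g_i^{-1}g_j)^* )\big)\Big)\,\sigma(g_i,g_i^{-1}g_j)\Big]_{i,j}$ is positive in $M_n(A)$. $P(\Sigma)$ is the set of all positive definite elements of $L(\Sigma)$. *)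

theory Defs
  imports "HOL-Analysis.Analysis" "HOL-Library.Function_Algebras" "HOL-Algebra.Ring"
begin

text \<open>
  The superclass \<^class>\<open>monoid_mult\<close> is used for the unit, rather than \<^class>\<open>ring_1\<close> or
  \<^class>\<open>real_normed_algebra_1\<close>, so that the zero algebra is not excluded.
\<close>

class unital_cstar_algebra = banach + real_normed_algebra + monoid_mult +
  fixes scaleC :: "complex \<Rightarrow> 'a \<Rightarrow> 'a" (infixr "*\<^sub>C" 75)
    and star :: "'a \<Rightarrow> 'a"
  assumes scaleC_add_right: "c *\<^sub>C (a + b) = c *\<^sub>C a + c *\<^sub>C b"
    and scaleC_add_left: "(c + d) *\<^sub>C a = c *\<^sub>C a + d *\<^sub>C a"
    and scaleC_scaleC: "c *\<^sub>C (d *\<^sub>C a) = (c * d) *\<^sub>C a"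
    and scaleC_of_real: "complex_of_real r *\<^sub>C a = r *\<^sub>R a"
    and mult_scaleC_left: "(c *\<^sub>C a) * b = c *\<^sub>C (a * b)"
    and mult_scaleC_right: "a * (c *\<^sub>C b) = c *\<^sub>C (a * b)"
    and norm_scaleC: "norm (c *\<^sub>C a) = cmod c * norm a"
    and star_add: "star (a + b) = star a + star b"
    and star_scaleC: "star (c *\<^sub>C a) = cnj c *\<^sub>C star a"
    and star_mult: "star (a * b) = star b * star a"
    and star_star: "star (star a) = a"
    and cstar_identity: "norm (star a * a) = (norm a)\<^sup>2"

definition cstar_positive :: "'a::unital_cstar_algebra \<Rightarrow> bool" where
  "cstar_positive a \<longleftrightarrow> (\<exists>b. a = star b * b)"

text \<open>
  An element of \<open>M\<^sub>n(A)\<close> is represented by a function of two indices, of which only the values at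
  indices below \<open>n\<close> matter; it is positive if it has the form \<open>N\<^sup>* N\<close> in the *-algebra \<open>M\<^sub>n(A)\<close>.
\<close>

definition matrix_positive :: "nat \<Rightarrow> (nat \<Rightarrow> nat \<Rightarrow> 'a::unital_cstar_algebra) \<Rightarrow> bool" where
  "matrix_positive n M \<longleftrightarrow>
     (\<exists>N. \<forall>i<n. \<forall>j<n. M i j = (\<Sum>k<n. star (N k i) * N k j))"

definition cstar_unitary :: "'a::unital_cstar_algebra \<Rightarrow> bool" where
  "cstar_unitary u \<longleftrightarrow> star u * u = 1 \<and> u * star u = 1"

definition cstar_automorphism :: "('a::unital_cstar_algebra \<Rightarrow> 'a) \<Rightarrow> bool" where
  "cstar_automorphism f \<longleftrightarrow> bij f \<and>
     (\<forall>a b. f (a + b) = f a + f b) \<and> (\<forall>c a. f (c *\<^sub>C a) = c *\<^sub>C f a) \<and>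
     (\<forall>a b. f (a * b) = f a * f b) \<and> (\<forall>a. f (star a) = star (f a)) \<and> f 1 = 1"

text \<open>
  The discrete group is a type of class \<^class>\<open>group_add\<close>. This class does not assume
  commutativity; in its additive notation, \<open>g + h\<close>, \<open>0\<close> and \<open>- g\<close> stand for \<open>gh\<close>, \<open>e\<close>
  and \<open>g\<^sup>-\<^sup>1\<close>.
\<close>

locale twisted_dynamical_system =
  fixes \<alpha> :: "'g::group_add \<Rightarrow> 'a::unital_cstar_algebra \<Rightarrow> 'a"
    and \<sigma> :: "'g \<Rightarrow> 'g \<Rightarrow> 'a"
  assumes automorphism: "cstar_automorphism (\<alpha> g)"
    and unitary: "cstar_unitary (\<sigma> g h)"
    and twisted_action: "\<alpha> g (\<alpha> h a) = \<sigma> g h * \<alpha> (g + h) a * star (\<sigma> g h)"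
    and cocycle: "\<sigma> g h * \<sigma> (g + h) k = \<alpha> g (\<sigma> h k) * \<sigma> g (h + k)"
    and normalized_right: "\<sigma> g 0 = 1"
    and normalized_left: "\<sigma> 0 g = 1"

text \<open>
  As for modules in HOL-Algebra, the additive group is carried by a \<open>ring\<close> record, of which the
  multiplicative fields are ignored.
\<close>

record ('a, 'x) module_data = "'x ring" +
  cscale :: "complex \<Rightarrow> 'x \<Rightarrow> 'x"
  act :: "'x \<Rightarrow> 'a \<Rightarrow> 'x"
  inner_prod :: "'x \<Rightarrow> 'x \<Rightarrow> 'a"

definition hnorm :: "('a::unital_cstar_algebra, 'x) module_data \<Rightarrow> 'x \<Rightarrow> real" where
  "hnorm X x = sqrt (norm (inner_prod X x x))"

locale hilbert_module = abelian_group X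
  for X :: "('a::unital_cstar_algebra, 'x) module_data" (structure) +
  assumes cscale_closed: "x \<in> carrier X \<Longrightarrow> cscale X c x \<in> carrier X"
    and cscale_add_right: "x \<in> carrier X \<Longrightarrow> y \<in> carrier X \<Longrightarrow>
          cscale X c (x \<oplus> y) = cscale X c x \<oplus> cscale X c y"
    and cscale_add_left: "x \<in> carrier X \<Longrightarrow> cscale X (c + d) x = cscale X c x \<oplus> cscale X d x"
    and cscale_cscale: "x \<in> carrier X \<Longrightarrow> cscale X c (cscale X d x) = cscale X (c * d) x"
    and cscale_one: "x \<in> carrier X \<Longrightarrow> cscale X 1 x = x"
    and act_closed: "x \<in> carrier X \<Longrightarrow> act X x a \<in> carrier X"
    and act_add_left: "x \<in> carrier X \<Longrightarrow> y \<in> carrier X \<Longrightarrow>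
          act X (x \<oplus> y) a = act X x a \<oplus> act X y a"
    and act_add_right: "x \<in> carrier X \<Longrightarrow> act X x (a + b) = act X x a \<oplus> act X x b"
    and act_act: "x \<in> carrier X \<Longrightarrow> act X (act X x a) b = act X x (a * b)"
    and act_one: "x \<in> carrier X \<Longrightarrow> act X x 1 = x"
    and cscale_act: "x \<in> carrier X \<Longrightarrow> cscale X c (act X x a) = act X (cscale X c x) a"
    and act_scaleC: "x \<in> carrier X \<Longrightarrow> act X x (c *\<^sub>C a) = cscale X c (act X x a)"
    and inner_add: "x \<in> carrier X \<Longrightarrow> y \<in> carrier X \<Longrightarrow> z \<in> carrier X \<Longrightarrow>
          inner_prod X x (y \<oplus> z) = inner_prod X x y + inner_prod X x z"
    and inner_cscale: "x \<in> carrier X \<Longrightarrow> y \<in> carrier X \<Longrightarrow>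
          inner_prod X x (cscale X c y) = c *\<^sub>C inner_prod X x y"
    and inner_act: "x \<in> carrier X \<Longrightarrow> y \<in> carrier X \<Longrightarrow>
          inner_prod X x (act X y a) = inner_prod X x y * a"
    and inner_star: "x \<in> carrier X \<Longrightarrow> y \<in> carrier X \<Longrightarrow>
          inner_prod X y x = star (inner_prod X x y)"
    and inner_positive: "x \<in> carrier X \<Longrightarrow> cstar_positive (inner_prod X x x)"
    and inner_definite: "x \<in> carrier X \<Longrightarrow> inner_prod X x x = 0 \<Longrightarrow> x = \<zero>"
    and complete: "range s \<subseteq> carrier X \<Longrightarrow>
          (\<forall>e>0. \<exists>N. \<forall>m\<ge>N. \<forall>n\<ge>N. hnorm X (s m \<ominus> s n) < e) \<Longrightarrow>
          \<exists>x\<in>carrier X. (\<lambda>n. hnorm X (s n \<ominus> x)) \<longlonglongrightarrow> 0"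

definition is_adjoint ::
    "('a::unital_cstar_algebra, 'x) module_data \<Rightarrow> ('x \<Rightarrow> 'x) \<Rightarrow> ('x \<Rightarrow> 'x) \<Rightarrow> bool" where
  "is_adjoint X T S \<longleftrightarrow> T \<in> carrier X \<rightarrow> carrier X \<and> S \<in> carrier X \<rightarrow> carrier X \<and>
     (\<forall>x\<in>carrier X. \<forall>y\<in>carrier X. inner_prod X (T x) y = inner_prod X x (S y))"

definition adjointable ::
    "('a::unital_cstar_algebra, 'x) module_data \<Rightarrow> ('x \<Rightarrow> 'x) \<Rightarrow> bool" where
  "adjointable X T \<longleftrightarrow> (\<exists>S. is_adjoint X T S)"

text \<open>
  Unital *-homomorphisms into the adjointable operators; operators are compared on the carrier only.
\<close>

definition star_representation ::
    "('a::unital_cstar_algebra, 'x) module_data \<Rightarrow> ('a \<Rightarrow> 'x \<Rightarrow> 'x) \<Rightarrow> bool" where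
  "star_representation X \<rho> \<longleftrightarrow>
     (\<forall>a. adjointable X (\<rho> a)) \<and>
     (\<forall>a b. \<forall>x\<in>carrier X. \<rho> (a + b) x = \<rho> a x \<oplus>\<^bsub>X\<^esub> \<rho> b x) \<and>
     (\<forall>c a. \<forall>x\<in>carrier X. \<rho> (c *\<^sub>C a) x = cscale X c (\<rho> a x)) \<and>
     (\<forall>a b. \<forall>x\<in>carrier X. \<rho> (a * b) x = \<rho> a (\<rho> b x)) \<and>
     (\<forall>a. is_adjoint X (\<rho> a) (\<rho> (star a))) \<and>
     (\<forall>x\<in>carrier X. \<rho> 1 x = x)"

definition bounded_invertible ::
    "('a::unital_cstar_algebra, 'x) module_data \<Rightarrow> ('x \<Rightarrow> 'x) \<Rightarrow> bool" where
  "bounded_invertible X w \<longleftrightarrow> bij_betw w (carrier X) (carrier X) \<and>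
     (\<forall>x\<in>carrier X. \<forall>y\<in>carrier X. w (x \<oplus>\<^bsub>X\<^esub> y) = w x \<oplus>\<^bsub>X\<^esub> w y) \<and>
     (\<forall>c. \<forall>x\<in>carrier X. w (cscale X c x) = cscale X c (w x)) \<and>
     (\<exists>K. \<forall>x\<in>carrier X. hnorm X (w x) \<le> K * hnorm X x)"

definition ad_rep ::
    "('a::unital_cstar_algebra, 'x) module_data \<Rightarrow> ('a \<Rightarrow> 'x \<Rightarrow> 'x) \<Rightarrow> 'a \<Rightarrow> 'x \<Rightarrow> 'x" where
  "ad_rep X \<rho> u x = act X (\<rho> u x) (star u)"

definition equivariant_representation ::
    "('g::group_add \<Rightarrow> 'a::unital_cstar_algebra \<Rightarrow> 'a) \<Rightarrow> ('g \<Rightarrow> 'g \<Rightarrow> 'a) \<Rightarrow>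
     ('a, 'x) module_data \<Rightarrow> ('a \<Rightarrow> 'x \<Rightarrow> 'x) \<Rightarrow> ('g \<Rightarrow> 'x \<Rightarrow> 'x) \<Rightarrow> bool" where
  "equivariant_representation \<alpha> \<sigma> X \<rho> v \<longleftrightarrow>
     star_representation X \<rho> \<and> (\<forall>g. bounded_invertible X (v g)) \<and>
     (\<forall>g a. \<forall>x\<in>carrier X. \<rho> (\<alpha> g a) x = v g (\<rho> a (inv_into (carrier X) (v g) x))) \<and>
     (\<forall>g h. \<forall>x\<in>carrier X. v g (v h x) = ad_rep X \<rho> (\<sigma> g h) (v (g + h) x)) \<and>
     (\<forall>g. \<forall>x\<in>carrier X. \<forall>x'\<in>carrier X.
        \<alpha> g (inner_prod X x x') = inner_prod X (v g x) (v g x')) \<and>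
     (\<forall>g a. \<forall>x\<in>carrier X. v g (act X x a) = act X (v g x) (\<alpha> g a))"

definition coefficient ::
    "('a::unital_cstar_algebra, 'x) module_data \<Rightarrow> ('a \<Rightarrow> 'x \<Rightarrow> 'x) \<Rightarrow> ('g \<Rightarrow> 'x \<Rightarrow> 'x) \<Rightarrow>
     'x \<Rightarrow> 'x \<Rightarrow> 'g \<Rightarrow> 'a \<Rightarrow> 'a" where
  "coefficient X \<rho> v x y g a = inner_prod X x (\<rho> a (v g y))"

text \<open>
  HOL has no quantifier over types, so \<open>B(\<Sigma>)\<close> is defined relative to a type \<open>'x\<close>: the Hilbert
  modules range over all those whose underlying set is a subset of \<open>'x\<close>.
\<close>

definition coefficient_maps ::
    "'x itself \<Rightarrow> ('g::group_add \<Rightarrow> 'a::unital_cstar_algebra \<Rightarrow> 'a) \<Rightarrow> ('g \<Rightarrow> 'g \<Rightarrow> 'a) \<Rightarrow>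
     ('g \<Rightarrow> 'a \<Rightarrow> 'a) set" where
  "coefficient_maps _ \<alpha> \<sigma> =
     {T. \<exists>(X :: ('a, 'x) module_data) \<rho> v x y.
           hilbert_module X \<and> equivariant_representation \<alpha> \<sigma> X \<rho> v \<and>
           x \<in> carrier X \<and> y \<in> carrier X \<and> T = coefficient X \<rho> v x y}"

text \<open>
  A type large enough for all coefficients: if \<open>T\<close> is a coefficient of \<open>(\<rho>, v)\<close> for the
  vectors \<open>x\<close>, \<open>y\<close>, one may replace the module by its smallest closed \<open>\<rho>\<close>- and \<open>v\<close>-invariant
  submodule containing \<open>x\<close> and \<open>y\<close>. An element \<open>z\<close> of this submodule is determined by the
  inner products of \<open>\<rho>(a) v(g) x\<close> and \<open>\<rho>(a) v(g) y\<close> with \<open>z\<close>, hence by an element of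
  this type.
\<close>

type_synonym ('g, 'a) universe = "nat \<times> 'g \<times> 'a \<Rightarrow> 'a"

definition linear_maps :: "('g \<Rightarrow> 'a::unital_cstar_algebra \<Rightarrow> 'a) set" where
  "linear_maps = {T. (\<forall>g a b. T g (a + b) = T g a + T g b) \<and> (\<forall>g c a. T g (c *\<^sub>C a) = c *\<^sub>C T g a)}"

definition positive_definite_maps ::
    "('g::group_add \<Rightarrow> 'a::unital_cstar_algebra \<Rightarrow> 'a) \<Rightarrow> ('g \<Rightarrow> 'g \<Rightarrow> 'a) \<Rightarrow>
     ('g \<Rightarrow> 'a \<Rightarrow> 'a) set" where
  "positive_definite_maps \<alpha> \<sigma> =
     {T \<in> linear_maps. \<forall>n (g :: nat \<Rightarrow> 'g) (a :: nat \<Rightarrow> 'a).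
        matrix_positive n (\<lambda>i j.
          \<alpha> (g i) (T (- g i + g j)
            (inv_into UNIV (\<alpha> (g i)) (star (a i) * a j * star (\<sigma> (g i) (- g i + g j)))))
          * \<sigma> (g i) (- g i + g j))}"

definition map_scaleC :: "complex \<Rightarrow> ('g \<Rightarrow> 'a::unital_cstar_algebra \<Rightarrow> 'a) \<Rightarrow> 'g \<Rightarrow> 'a \<Rightarrow> 'a" where
  "map_scaleC c T = (\<lambda>g a. c *\<^sub>C T g a)"

lemma vector_space_map_scaleC:
  "vector_space (map_scaleC :: complex \<Rightarrow> ('g \<Rightarrow> 'a::unital_cstar_algebra \<Rightarrow> 'a) \<Rightarrow> _)"
proof
  fix c d :: complex and S T :: "'g \<Rightarrow> 'a \<Rightarrow> 'a"
  show "map_scaleC c (S + T) = map_scaleC c S + map_scaleC c T"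
    by (simp add: map_scaleC_def fun_eq_iff scaleC_add_right)
  show "map_scaleC (c + d) T = map_scaleC c T + map_scaleC d T"
    by (simp add: map_scaleC_def fun_eq_iff scaleC_add_left)
  show "map_scaleC c (map_scaleC d T) = map_scaleC (c * d) T"
    by (simp add: map_scaleC_def scaleC_scaleC)
  have "1 *\<^sub>C a = a" for a :: 'a
    using scaleC_of_real[of 1 a] by simp
  then show "map_scaleC 1 T = T"
    by (simp add: map_scaleC_def)
qed

definition complex_span ::
    "('g \<Rightarrow> 'a::unital_cstar_algebra \<Rightarrow> 'a) set \<Rightarrow> ('g \<Rightarrow> 'a \<Rightarrow> 'a) set" where
  "complex_span = module.span map_scaleC"

end

theory Submission
  imports Defs
begin

text \<open>
  One inclusion is a computation. If \<open>T\<close> is the coefficient of \<open>(\<rho>, v)\<close> at \<open>x, x\<close>, then the matrix in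
  the definition of positive definiteness is the Gram matrix of the vectors \<open>\<rho>(a\<^sub>i) v(g\<^sub>i) x\<close>, the
  cocycle factors being exactly those produced by \<open>v(g) v(h) = ad(\<sigma>(g, h)) v(gh)\<close>
  (\<open>coefficient_positive_definite\<close>). Gram matrices in a Hilbert module are positive, so diagonal
  coefficients are positive definite, and polarization in \<open>x, y\<close> writes every coefficient as a
  combination of four diagonal ones (\<open>coefficient_maps_subset_span\<close>).

  The other inclusion is a GNS construction. Positive definiteness of \<open>T\<close> says that
  \<open>K((g, a), (h, b))\<close>, the entry of the same matrix, is a positive \<open>A\<close>-valued kernel on \<open>G \<times> A\<close>. The
  module is the reproducing kernel Hilbert module of \<open>K\<close>: it consists of functions \<open>G \<times> A \<rightarrow> A\<close>, and the
  function \<open>K(_, (g, a))\<close> plays the role of \<open>\<rho>(a) v(g) \<xi>\<close> for a cyclic vector \<open>\<xi>\<close>. This dictates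
  \<open>\<rho>\<close> and \<open>v\<close>: they send each kernel function to a right multiple of a kernel function. The
  cocycle identity makes \<open>v\<close> well defined (\<open>gns_kernel_shift\<close>), and \<open>\<rho>(c)\<close> is bounded by \<open>\<parallel>c\<parallel>\<close>
  since \<open>\<parallel>c\<parallel>\<^sup>2 - c\<^sup>*c\<close> is of the form \<open>d\<^sup>*d\<close> and \<open>T\<close> is linear in its second variable
  (\<open>comb_norm_rep\<close>). A linear combination \<open>\<Sum> c\<^sub>k T\<^sub>k\<close> needs a direct sum of such modules; the sum is
  built in one step by adding an index \<open>k\<close> and taking the block diagonal kernel. With
  \<open>x = \<Sum> \<xi>\<^sub>k\<close> and \<open>y = \<Sum> c\<^sub>k \<xi>\<^sub>k\<close>, the coefficient at \<open>x, y\<close> is the combination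
  (\<open>combination_is_coefficient\<close>). The elements of this module are functions on indices, group elements
  and algebra elements, which is why the type \<open>universe\<close> suffices.

  Both directions rest on the order structure of C*-algebras: sums of elements \<open>b\<^sup>*b\<close> are again of this
  form, \<open>0 \<le> a \<le> b\<close> implies \<open>\<parallel>a\<parallel> \<le> \<parallel>b\<parallel>\<close>, and a matrix \<open>M\<close> over \<open>A\<close> is of the form \<open>N\<^sup>*N\<close> as soon as
  all \<open>\<Sum> a\<^sub>i\<^sup>* M\<^sub>i\<^sub>j a\<^sub>j\<close> are positive (\<open>matrix_positiveI\<close>). These facts are derived without spectral
  theory. The only analytic tool is the power series of \<open>1 - sqrt(1 - x)\<close>, whose coefficients are
  nonnegative and have sum at most \<open>1\<close>; it yields square roots both in \<open>A\<close> and, entry by entry, of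
  matrices over \<open>A\<close>.
\<close>

section \<open>Involution and norm of a C*-algebra\<close>

lemma scaleC_1 [simp]: "1 *\<^sub>C (a::'a::unital_cstar_algebra) = a"
  using scaleC_of_real[of 1 a] by simp

lemma scaleC_minus1 [simp]: "(-1) *\<^sub>C (a::'a::unital_cstar_algebra) = - a"
  using scaleC_of_real[of "-1" a] by simp

lemma scaleC_minus_left: "(- c) *\<^sub>C (a::'a::unital_cstar_algebra) = - (c *\<^sub>C a)"
  using scaleC_scaleC[of "-1" c a] by simp

lemma bounded_linear_scaleC: "bounded_linear (\<lambda>a::'a::unital_cstar_algebra. c *\<^sub>C a)"
proof (rule bounded_linear_intro)
  fix r and x y :: 'a
  show "c *\<^sub>C (x + y) = c *\<^sub>C x + c *\<^sub>C y" by (rule scaleC_add_right)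
  show "c *\<^sub>C (r *\<^sub>R x) = r *\<^sub>R (c *\<^sub>C x)"
    by (simp add: scaleC_of_real[symmetric] scaleC_scaleC mult.commute)
  show "norm (c *\<^sub>C x) \<le> norm x * cmod c" by (simp add: norm_scaleC mult.commute)
qed

lemmas scaleC_zero_right [simp] = linear_0[OF bounded_linear.linear[OF bounded_linear_scaleC]]
  and scaleC_diff_right = linear_diff[OF bounded_linear.linear[OF bounded_linear_scaleC]]
  and tendsto_scaleC = bounded_linear.tendsto[OF bounded_linear_scaleC]

lemma norm_star [simp]: "norm (star a) = norm (a::'a::unital_cstar_algebra)"
proof -
  have "norm b \<le> norm (star b)" for b :: 'a
  proof (cases "b = 0")
    case False
    have "norm b * norm b \<le> norm (star b) * norm b"
      using cstar_identity[of b] norm_mult_ineq[of "star b" b] by (simp add: power2_eq_square)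
    then show ?thesis using False by simp
  qed simp
  from this[of a] this[of "star a"] show ?thesis by (simp add: star_star)
qed

lemma bounded_linear_star: "bounded_linear (star :: 'a::unital_cstar_algebra \<Rightarrow> 'a)"
proof (rule bounded_linear_intro)
  fix r and x y :: 'a
  show "star (x + y) = star x + star y" by (rule star_add)
  show "star (r *\<^sub>R x) = r *\<^sub>R (star x)"
    by (simp add: scaleC_of_real[symmetric] star_scaleC)
  show "norm (star x) \<le> norm x * 1" by simp
qed

lemmas star_zero [simp] = linear_0[OF bounded_linear.linear[OF bounded_linear_star]]
  and star_minus [simp] = linear_neg[OF bounded_linear.linear[OF bounded_linear_star]]
  and star_diff = linear_diff[OF bounded_linear.linear[OF bounded_linear_star]]
  and star_sum = linear_sum[OF bounded_linear.linear[OF bounded_linear_star]]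
  and star_scaleR [simp] = linear_scale[OF bounded_linear.linear[OF bounded_linear_star]]
  and tendsto_star = bounded_linear.tendsto[OF bounded_linear_star]

declare star_star [simp]

lemma star_one [simp]: "star 1 = (1::'a::unital_cstar_algebra)"
  by (metis star_mult star_star mult_1_left)

lemma norm_one_le: "norm (1::'a::unital_cstar_algebra) \<le> 1"
proof -
  have "norm (1::'a) = norm (1::'a) * norm (1::'a)"
    using cstar_identity[of "1::'a"] by (simp add: power2_eq_square)
  then show ?thesis by (cases "norm (1::'a) = 0") auto
qed

lemma star_power: "star (a ^ n) = star (a::'a::unital_cstar_algebra) ^ n"
  by (induction n) (simp_all add: star_mult power_commutes)

lemma norm_power_le: "norm (a ^ n) \<le> norm (a::'a::unital_cstar_algebra) ^ n"
proof (induction n)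
  case (Suc n)
  then show ?case
    using norm_mult_ineq[of a "a ^ n"] by (simp add: order_trans[OF _ mult_left_mono])
qed (simp add: norm_one_le)

lemma norm_selfadjoint_square: "star h = h \<Longrightarrow> norm (h * h) = norm (h::'a::unital_cstar_algebra) ^ 2"
  using cstar_identity[of h] by simp

lemma norm_selfadjoint_power_two:
  "star h = h \<Longrightarrow> norm (h ^ 2 ^ m) = norm (h::'a::unital_cstar_algebra) ^ 2 ^ m"
proof (induction m)
  case (Suc m)
  have "norm (h ^ 2 ^ m * h ^ 2 ^ m) = norm (h ^ 2 ^ m) ^ 2"
    using Suc.prems by (intro norm_selfadjoint_square) (simp add: star_power)
  with Suc show ?case
    by (simp add: power_add[symmetric] mult_2 power2_eq_square)
qed simp

section \<open>Square roots by power series\<close>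

text \<open>
  The Taylor coefficients of \<open>f(x) = 1 - sqrt(1 - x)\<close>; the recursion is the identity
  \<open>2 f = x + f\<^sup>2\<close>.
\<close>

fun sqrt_coeff :: "nat \<Rightarrow> real" where
  "sqrt_coeff n = (if n = 0 then 0 else if n = 1 then 1 / 2
     else (\<Sum>i\<in>{1..<n}. sqrt_coeff i * sqrt_coeff (n - i)) / 2)"

declare sqrt_coeff.simps [simp del]

lemma sqrt_coeff_0 [simp]: "sqrt_coeff 0 = 0"
  by (simp add: sqrt_coeff.simps)

lemma sqrt_coeff_nonneg: "sqrt_coeff n \<ge> 0"
proof (induction n rule: less_induct)
  case (less n)
  have "(\<Sum>i\<in>{1..<n}. sqrt_coeff i * sqrt_coeff (n - i)) \<ge> 0"
    by (intro sum_nonneg mult_nonneg_nonneg less) auto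
  then show ?case by (subst sqrt_coeff.simps) auto
qed

lemma sqrt_coeff_convolution:
  "(\<Sum>i\<le>n. sqrt_coeff i * sqrt_coeff (n - i)) = 2 * sqrt_coeff n - (if n = 1 then 1 else 0)"
proof -
  have "(\<Sum>i\<le>n. sqrt_coeff i * sqrt_coeff (n - i)) = (\<Sum>i\<in>{1..<n}. sqrt_coeff i * sqrt_coeff (n - i))"
    by (rule sum.mono_neutral_right) (auto simp: not_less le_less)
  also have "\<dots> = 2 * sqrt_coeff n - (if n = 1 then 1 else 0)"
    by (subst (3) sqrt_coeff.simps) auto
  finally show ?thesis .
qed

text \<open>
  The partial sums \<open>F\<^sub>n\<close> satisfy \<open>2 F\<^sub>n\<^sub>+\<^sub>1 \<le> 1 + F\<^sub>n\<^sup>2\<close>, because every nonzero product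
  contributing to a convolution of order at most \<open>n + 1\<close> has both indices at most \<open>n\<close>. So the bound \<open>1\<close> is
  preserved by induction.
\<close>

lemma sqrt_coeff_sum_le: "(\<Sum>k\<le>n. sqrt_coeff k) \<le> 1"
proof (induction n)
  case (Suc n)
  let ?c = sqrt_coeff
  have "2 * (\<Sum>k\<le>Suc n. ?c k) = (\<Sum>k\<le>Suc n. (if k = 1 then 1 else 0) + (\<Sum>i\<le>k. ?c i * ?c (k - i)))"
    by (subst sum_distrib_left, rule sum.cong) (auto simp: sqrt_coeff_convolution)
  also have "\<dots> = 1 + (\<Sum>k\<le>Suc n. \<Sum>i\<le>k. ?c i * ?c (k - i))"
    by (simp add: sum.distrib del: sum.atMost_Suc)
  also have "(\<Sum>k\<le>Suc n. \<Sum>i\<le>k. ?c i * ?c (k - i)) =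
      (\<Sum>(i,j)\<in>{(i,j). i + j \<le> Suc n}. ?c i * ?c j)"
    by (simp only: sum.triangle_reindex_eq)
  also have "\<dots> = (\<Sum>(i,j)\<in>{(i,j). i + j \<le> Suc n \<and> i \<le> n \<and> j \<le> n}. ?c i * ?c j)"
  proof (rule sum.mono_neutral_right)
    show "finite {(i,j). i + j \<le> Suc n}"
      by (rule finite_subset[of _ "{..Suc n} \<times> {..Suc n}"]) auto
  next
    show "\<forall>p\<in>{(i, j). i + j \<le> Suc n} - {(i, j). i + j \<le> Suc n \<and> i \<le> n \<and> j \<le> n}.
      (case p of (i, j) \<Rightarrow> ?c i * ?c j) = 0"
    proof
      fix p assume "p \<in> {(i, j). i + j \<le> Suc n} - {(i, j). i + j \<le> Suc n \<and> i \<le> n \<and> j \<le> n}"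
      then obtain i j where p: "p = (i, j)" "i + j \<le> Suc n" "\<not> (i \<le> n \<and> j \<le> n)"
        by auto
      then have "i = 0 \<or> j = 0" by auto
      then show "(case p of (i, j) \<Rightarrow> ?c i * ?c j) = 0" using p(1) by auto
    qed
  qed auto
  also have "\<dots> \<le> (\<Sum>(i,j)\<in>{..n} \<times> {..n}. ?c i * ?c j)"
    by (rule sum_mono2) (auto simp: sqrt_coeff_nonneg)
  also have "\<dots> = (\<Sum>i\<le>n. ?c i) * (\<Sum>j\<le>n. ?c j)"
    by (simp add: sum_product sum.cartesian_product)
  also have "\<dots> \<le> 1 * 1"
    by (rule mult_mono) (auto intro!: Suc sum_nonneg simp: sqrt_coeff_nonneg)
  finally show ?case by simp
qed simp

lemma sqrt_coeff_summable: "summable sqrt_coeff"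
  by (rule bounded_imp_summable[of _ 1]) (auto simp: sqrt_coeff_nonneg sqrt_coeff_sum_le)

text \<open>
  For \<open>P k = T\<^sup>k\<close> this is \<open>sqrt(1 - T)\<close>. The powers enter as a sequence so that the same series
  applies to a fixed entry of the powers of a matrix.
\<close>

definition sqrt_series :: "(nat \<Rightarrow> 'a::unital_cstar_algebra) \<Rightarrow> 'a" where
  "sqrt_series P = P 0 - (\<Sum>k. sqrt_coeff k *\<^sub>R P k)"

lemma sqrt_series_summable_norm:
  assumes "\<And>k. norm (P k :: 'a::unital_cstar_algebra) \<le> C"
  shows "summable (\<lambda>k. norm (sqrt_coeff k *\<^sub>R P k))"
proof (rule summable_comparison_test')
  show "summable (\<lambda>k. sqrt_coeff k * C)"
    by (rule summable_mult2[OF sqrt_coeff_summable])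
  show "norm (norm (sqrt_coeff k *\<^sub>R P k)) \<le> sqrt_coeff k * C" for k
    using mult_left_mono[OF assms sqrt_coeff_nonneg] by (simp add: sqrt_coeff_nonneg)
qed

lemma sqrt_series_bounded_linear:
  assumes "bounded_linear F" "\<And>k. norm (P k :: 'a::unital_cstar_algebra) \<le> C"
  shows "F (sqrt_series P) = sqrt_series (\<lambda>k. F (P k) :: 'a::unital_cstar_algebra)"
proof -
  interpret bounded_linear F by fact
  have "summable (\<lambda>k. sqrt_coeff k *\<^sub>R P k)"
    by (rule summable_norm_cancel[OF sqrt_series_summable_norm[OF assms(2)]])
  then show ?thesis
    unfolding sqrt_series_def diff by (simp add: suminf scaleR)
qed

lemma sqrt_series_sums:
  assumes "\<And>k. norm (P k :: 'a::unital_cstar_algebra) \<le> C"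
  shows "(\<lambda>k. sqrt_coeff k *\<^sub>R P k) sums (P 0 - sqrt_series P)"
  using summable_norm_cancel[OF sqrt_series_summable_norm[OF assms]]
  by (simp add: sqrt_series_def summable_sums)

text \<open>
  The hypothesis \<open>add\<close> says that \<open>p \<mapsto> P p\<close> is multiplicative for the matrix product; \<open>P 0\<close> then acts as
  a unit, and \<open>R = P 0 - sqrt_series P\<close> satisfies \<open>R\<^sup>2 = 2 R - P 1\<close> by the Cauchy product. Case \<open>n = 1\<close>
  is the square root in \<open>A\<close>, the general case the square root of a matrix.
\<close>

lemma sqrt_series_square:
  fixes P :: "nat \<Rightarrow> nat \<Rightarrow> nat \<Rightarrow> 'a::unital_cstar_algebra"
  assumes add: "\<And>p q i j. i < n \<Longrightarrow> j < n \<Longrightarrow> P (p + q) i j = (\<Sum>l<n. P p i l * P q l j)"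
    and bnd: "\<And>k i j. i < n \<Longrightarrow> j < n \<Longrightarrow> norm (P k i j) \<le> C"
    and ij: "i < n" "j < n"
  shows "(\<Sum>l<n. sqrt_series (\<lambda>k. P k i l) * sqrt_series (\<lambda>k. P k l j)) = P 0 i j - P 1 i j"
proof -
  let ?c = sqrt_coeff
  define R where "R i j = P 0 i j - sqrt_series (\<lambda>k. P k i j)" for i j
  have R: "(\<lambda>k. ?c k *\<^sub>R P k i j) sums R i j" if "i < n" "j < n" for i j
    unfolding R_def by (rule sqrt_series_sums) (rule bnd[OF that])
  have left: "(\<Sum>l<n. P 0 i l * R l j) = R i j"
  proof -
    have "(\<lambda>k. \<Sum>l<n. P 0 i l * (?c k *\<^sub>R P k l j)) sums (\<Sum>l<n. P 0 i l * R l j)"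
      by (intro sums_sum bounded_linear.sums[OF bounded_linear_mult_right] R) (use ij in auto)
    moreover have "(\<Sum>l<n. P 0 i l * (?c k *\<^sub>R P k l j)) = ?c k *\<^sub>R P k i j" for k
      using add[of i j 0 k] ij by (simp add: scaleR_sum_right)
    ultimately show ?thesis using R[OF ij] by (simp add: sums_unique2)
  qed
  have right: "(\<Sum>l<n. R i l * P 0 l j) = R i j"
  proof -
    have "(\<lambda>k. \<Sum>l<n. (?c k *\<^sub>R P k i l) * P 0 l j) sums (\<Sum>l<n. R i l * P 0 l j)"
      by (intro sums_sum bounded_linear.sums[OF bounded_linear_mult_left] R) (use ij in auto)
    moreover have "(\<Sum>l<n. (?c k *\<^sub>R P k i l) * P 0 l j) = ?c k *\<^sub>R P k i j" for k
      using add[of i j k 0] ij by (simp add: scaleR_sum_right)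
    ultimately show ?thesis using R[OF ij] by (simp add: sums_unique2)
  qed
  have RR: "(\<Sum>l<n. R i l * R l j) = 2 *\<^sub>R R i j - P 1 i j"
  proof -
    have "(\<lambda>k. \<Sum>p\<le>k. (?c p *\<^sub>R P p i l) * (?c (k - p) *\<^sub>R P (k - p) l j)) sums (R i l * R l j)"
      if "l < n" for l
    proof -
      have "(\<lambda>k. \<Sum>p\<le>k. (?c p *\<^sub>R P p i l) * (?c (k - p) *\<^sub>R P (k - p) l j)) sums
        ((\<Sum>k. ?c k *\<^sub>R P k i l) * (\<Sum>k. ?c k *\<^sub>R P k l j))"
        by (intro Cauchy_product_sums sqrt_series_summable_norm[where C = C] bnd) (use ij that in auto)
      then show ?thesis
        using R[OF ij(1) that] R[OF that ij(2)] by (simp add: sums_iff)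
    qed
    then have "(\<lambda>k. \<Sum>l<n. \<Sum>p\<le>k. (?c p *\<^sub>R P p i l) * (?c (k - p) *\<^sub>R P (k - p) l j)) sums
        (\<Sum>l<n. R i l * R l j)"
      by (intro sums_sum) auto
    moreover have "(\<Sum>l<n. \<Sum>p\<le>k. (?c p *\<^sub>R P p i l) * (?c (k - p) *\<^sub>R P (k - p) l j)) =
        2 *\<^sub>R (?c k *\<^sub>R P k i j) - (if k = 1 then P k i j else 0)" for k
    proof -
      have "(\<Sum>l<n. \<Sum>p\<le>k. (?c p *\<^sub>R P p i l) * (?c (k - p) *\<^sub>R P (k - p) l j)) =
        (\<Sum>p\<le>k. \<Sum>l<n. (?c p * ?c (k - p)) *\<^sub>R (P p i l * P (k - p) l j))"
        by (subst sum.swap) (simp add: mult.commute)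
      also have "\<dots> = (\<Sum>p\<le>k. (?c p * ?c (k - p)) *\<^sub>R P k i j)"
        by (rule sum.cong) (auto simp: scaleR_sum_right[symmetric] add[OF ij, symmetric])
      also have "\<dots> = (2 * ?c k - (if k = 1 then 1 else 0)) *\<^sub>R P k i j"
        by (simp add: scaleR_sum_left[symmetric] sqrt_coeff_convolution)
      also have "\<dots> = 2 *\<^sub>R (?c k *\<^sub>R P k i j) - (if k = 1 then P k i j else 0)"
        by (simp add: scaleR_diff_left)
      finally show ?thesis .
    qed
    moreover have "(\<lambda>k. 2 *\<^sub>R (?c k *\<^sub>R P k i j) - (if k = 1 then P k i j else 0)) sums
        (2 *\<^sub>R R i j - P 1 i j)"
      by (intro sums_diff sums_scaleR_right R ij sums_single)
    ultimately show ?thesis by (simp add: sums_unique2)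
  qed
  have "(\<Sum>l<n. sqrt_series (\<lambda>k. P k i l) * sqrt_series (\<lambda>k. P k l j)) =
    (\<Sum>l<n. (P 0 i l - R i l) * (P 0 l j - R l j))"
    by (simp add: R_def)
  also have "\<dots> = (\<Sum>l<n. P 0 i l * P 0 l j) - (\<Sum>l<n. P 0 i l * R l j)
      - (\<Sum>l<n. R i l * P 0 l j) + (\<Sum>l<n. R i l * R l j)"
    by (simp add: algebra_simps sum.distrib sum_subtractf)
  also have "\<dots> = P 0 i j - P 1 i j"
    unfolding left right RR using add[OF ij, of 0 0] by (simp add: scaleR_2)
  finally show ?thesis .
qed

lemma sqrt_one_minus:
  fixes T :: "'a::unital_cstar_algebra"
  assumes "norm T \<le> 1" "star T = T"
  obtains k where "star k = k" "k * k = 1 - T" "norm (1 - k) \<le> 1"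
    "\<And>b. b * T = T * b \<Longrightarrow> b * k = k * b"
proof
  let ?k = "sqrt_series (\<lambda>k. T ^ k)"
  have bnd: "norm (T ^ k) \<le> 1" for k
    using norm_power_le[of T k] power_le_one[OF norm_ge_zero assms(1), of k] by linarith
  show "star ?k = ?k"
    using sqrt_series_bounded_linear[OF bounded_linear_star bnd] assms(2) by (simp add: star_power)
  show "?k * ?k = 1 - T"
    using sqrt_series_square[of 1 "\<lambda>k i j. T ^ k" 1 0 0] bnd by (simp add: power_add)
  have "norm (1 - ?k) \<le> (\<Sum>k. norm (sqrt_coeff k *\<^sub>R T ^ k))"
    using summable_norm[OF sqrt_series_summable_norm[OF bnd]] by (simp add: sqrt_series_def)
  also have "\<dots> \<le> (\<Sum>k. sqrt_coeff k)"
    by (intro suminf_le sqrt_series_summable_norm[OF bnd] sqrt_coeff_summable)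
      (use bnd in \<open>auto simp: sqrt_coeff_nonneg intro: mult_left_le\<close>)
  also have "\<dots> \<le> 1"
  proof (rule LIMSEQ_le_const2)
    show "(\<lambda>n. \<Sum>k<n. sqrt_coeff k) \<longlonglongrightarrow> (\<Sum>k. sqrt_coeff k)"
      by (rule summable_LIMSEQ[OF sqrt_coeff_summable])
    have "(\<Sum>k<n. sqrt_coeff k) \<le> 1" for n
      using sqrt_coeff_sum_le[of n] sqrt_coeff_nonneg[of n] by (simp add: lessThan_Suc_atMost[symmetric])
    then show "\<exists>N. \<forall>n\<ge>N. (\<Sum>k<n. sqrt_coeff k) \<le> 1" by blast
  qed
  finally show "norm (1 - ?k) \<le> 1" .
  show "b * ?k = ?k * b" if "b * T = T * b" for b
  proof -
    have "b * T ^ k = T ^ k * b" for k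
      by (induction k) (simp_all add: that mult.assoc[symmetric], metis that mult.assoc)
    then show ?thesis
      using sqrt_series_bounded_linear[OF bounded_linear_mult_right[of b] bnd]
        sqrt_series_bounded_linear[OF bounded_linear_mult_left[of b] bnd] by simp
  qed
qed

section \<open>Positive elements of a C*-algebra\<close>

text \<open>
  An auxiliary description of positivity by the norm, under which the positive elements visibly
  form a convex cone. In terms of the spectrum, it says that the spectrum of the selfadjoint \<open>h\<close> lies in
  \<open>[0, 2t]\<close>. The aim is to show that it is equivalent to the form \<open>b\<^sup>*b\<close>.
\<close>

definition norm_positive :: "'a::unital_cstar_algebra \<Rightarrow> bool" where
  "norm_positive h \<longleftrightarrow> star h = h \<and> (\<exists>t\<ge>0. norm (t *\<^sub>R 1 - h) \<le> t)"

text \<open>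
  The square root inherits commutation relations since it is a limit of polynomials in \<open>h\<close>; this
  replaces the functional calculus below. It is itself positive because the tail of the series has norm
  at most \<open>1\<close>.
\<close>

lemma norm_positive_sqrt:
  assumes "norm_positive (h::'a::unital_cstar_algebra)"
  obtains k where "norm_positive k" "k * k = h" "\<And>b. b * h = h * b \<Longrightarrow> b * k = k * b"
proof -
  from assms obtain t where h: "star h = h" and t: "t \<ge> 0" "norm (t *\<^sub>R 1 - h) \<le> t"
    by (auto simp: norm_positive_def)
  show ?thesis
  proof (cases "t = 0")
    case True
    with t have "h = 0" by simp
    then show ?thesis by (intro that[of 0]) (auto simp: norm_positive_def intro: exI[of _ 0])
  next
    case False
    with t have t0: "t > 0" by simp
    define T where "T = 1 - (1 / t) *\<^sub>R h"
    have "T = (1 / t) *\<^sub>R (t *\<^sub>R 1 - h)"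
      using t0 by (simp add: T_def scaleR_diff_right)
    then have "norm T = norm (t *\<^sub>R 1 - h) / t" using t0 by simp
    also have "\<dots> \<le> 1" using t t0 by simp
    finally have T: "norm T \<le> 1" "star T = T" by (simp_all add: T_def star_diff h)
    from sqrt_one_minus[OF this] obtain k where k: "star k = k" "k * k = 1 - T" "norm (1 - k) \<le> 1"
      "\<And>b. b * T = T * b \<Longrightarrow> b * k = k * b" by blast
    show ?thesis
    proof (rule that[of "sqrt t *\<^sub>R k"])
      have "norm (sqrt t *\<^sub>R 1 - sqrt t *\<^sub>R k) = sqrt t * norm (1 - k)"
        using t0 by (simp add: scaleR_diff_right[symmetric])
      also have "\<dots> \<le> sqrt t" using k(3) t0 by (simp add: mult_left_le)
      finally show "norm_positive (sqrt t *\<^sub>R k)"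
        using k(1) t0 by (auto simp: norm_positive_def intro!: exI[of _ "sqrt t"])
      show "sqrt t *\<^sub>R k * sqrt t *\<^sub>R k = h"
        using k(2) t0 by (simp add: T_def)
      show "b * sqrt t *\<^sub>R k = sqrt t *\<^sub>R k * b" if "b * h = h * b" for b
        using k(4)[of b] that by (simp add: T_def algebra_simps)
    qed
  qed
qed

lemma norm_positive_selfadjoint: "norm_positive h \<Longrightarrow> star h = h"
  by (simp add: norm_positive_def)

text \<open>
  With \<open>w = x + i y\<close> one has \<open>w\<^sup>*w = x\<^sup>2 + y\<^sup>2\<close>, and \<open>x\<close>, the real part of \<open>w\<close>, has norm at most \<open>\<parallel>w\<parallel>\<close>.
\<close>

lemma norm_square_le_commuting:
  fixes x y :: "'a::unital_cstar_algebra"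
  assumes sa: "star x = x" "star y = y" and comm: "x * y = y * x"
  shows "norm (x * x) \<le> norm (x * x + y * y)"
proof -
  define w where "w = x + \<i> *\<^sub>C y"
  have sw: "star w = x - \<i> *\<^sub>C y"
    using scaleC_scaleC[of "-1" \<i> y] by (simp add: w_def star_add star_scaleC sa)
  have "star w * w = x * x + y * y"
    unfolding sw by (simp add: w_def distrib_left left_diff_distrib mult_scaleC_left mult_scaleC_right
        scaleC_diff_right scaleC_add_right scaleC_scaleC comm)
  then have w: "norm w ^ 2 = norm (x * x + y * y)"
    using cstar_identity[of w] by simp
  have "2 *\<^sub>R x = w + star w" unfolding sw by (simp add: w_def scaleR_2)
  then have "2 * norm x = norm (w + star w)"
    by (metis norm_scaleR abs_numeral)
  also have "\<dots> \<le> 2 * norm w" using norm_triangle_ineq[of w "star w"] by simp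
  finally have "norm x ^ 2 \<le> norm w ^ 2" by (intro power_mono) auto
  then show ?thesis using w norm_selfadjoint_square[OF sa(1)] by simp
qed

text \<open>
  With \<open>u = sqrt(1 - k\<^sup>2)\<close>, \<open>norm_square_le_commuting\<close> gives \<open>\<parallel>u\<^sup>2\<parallel> \<le> \<parallel>u\<^sup>2 + k\<^sup>2\<parallel> = \<parallel>1\<parallel>\<close>.
\<close>

lemma norm_one_minus_square:
  assumes "star k = k" "norm k \<le> 1"
  shows "norm (1 - k * k :: 'a::unital_cstar_algebra) \<le> 1"
proof -
  have T: "norm (k * k) \<le> 1" "star (k * k) = k * k"
    using assms by (auto simp: star_mult norm_selfadjoint_square power_le_one)
  obtain u where u: "star u = u" "u * u = 1 - k * k" "\<And>b. b * (k * k) = (k * k) * b \<Longrightarrow> b * u = u * b"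
    using sqrt_one_minus[OF T] by metis
  have "k * u = u * k" by (rule u(3)) (simp add: mult.assoc)
  then have "norm (u * u) \<le> norm (u * u + k * k)"
    by (intro norm_square_le_commuting u(1) assms(1)) simp
  also have "\<dots> \<le> 1" using u(2) norm_one_le by simp
  finally show ?thesis using u(2) by simp
qed

lemma norm_diff_square_le:
  assumes "star k = k" "norm k ^ 2 \<le> t"
  shows "norm (t *\<^sub>R 1 - k * k :: 'a::unital_cstar_algebra) \<le> t"
proof (cases "t > 0")
  case True
  have "norm ((1 / sqrt t) *\<^sub>R k) \<le> 1"
    using assms(2) True by (simp add: real_le_rsqrt)
  then have "norm (1 - (1 / sqrt t) *\<^sub>R k * (1 / sqrt t) *\<^sub>R k) \<le> 1"
    by (intro norm_one_minus_square) (simp_all add: assms)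
  also have "1 - (1 / sqrt t) *\<^sub>R k * (1 / sqrt t) *\<^sub>R k = (1 / t) *\<^sub>R (t *\<^sub>R 1 - k * k)"
    using True by (simp add: scaleR_diff_right)
  finally have "\<bar>1 / t\<bar> * norm (t *\<^sub>R 1 - k * k) \<le> 1" by (simp only: norm_scaleR)
  then show ?thesis using True by (simp add: field_simps)
next
  case False
  then have "norm k ^ 2 = 0" "t = 0"
    using assms(2) zero_le_power2[of "norm k"] by linarith+
  then show ?thesis by simp
qed

lemma norm_positive_square:
  assumes "star k = k"
  shows "norm_positive (k * k)"
  unfolding norm_positive_def using norm_diff_square_le[OF assms order_refl]
  by (auto simp: star_mult assms intro!: exI[of _ "norm k ^ 2"])

lemma norm_positive_norm_diff_le:
  assumes "norm_positive h" "norm h \<le> t"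
  shows "norm (t *\<^sub>R 1 - h) \<le> t"
proof -
  obtain k where k: "norm_positive k" "k * k = h" using norm_positive_sqrt[OF assms(1)] by metis
  then have "norm k ^ 2 = norm h" using norm_selfadjoint_square norm_positive_selfadjoint by metis
  then show ?thesis using norm_diff_square_le[of k t] k norm_positive_selfadjoint assms(2) by metis
qed

lemma norm_positive_add:
  assumes "norm_positive a" "norm_positive b"
  shows "norm_positive (a + b)"
proof -
  from assms obtain s t where "star a = a" "star b = b"
    "s \<ge> 0" "norm (s *\<^sub>R 1 - a) \<le> s" "t \<ge> 0" "norm (t *\<^sub>R 1 - b) \<le> t"
    by (auto simp: norm_positive_def)
  moreover have "norm ((s + t) *\<^sub>R 1 - (a + b)) \<le> norm (s *\<^sub>R 1 - a) + norm (t *\<^sub>R 1 - b)"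
    using norm_triangle_ineq[of "s *\<^sub>R 1 - a" "t *\<^sub>R 1 - b"] by (simp add: algebra_simps)
  ultimately show ?thesis
    by (auto simp: norm_positive_def star_add intro!: exI[of _ "s + t"])
qed

lemma norm_positive_scaleR:
  assumes "norm_positive a" "r \<ge> 0"
  shows "norm_positive (r *\<^sub>R a)"
proof -
  from assms obtain s where "star a = a" "s \<ge> 0" "norm (s *\<^sub>R 1 - a) \<le> s"
    by (auto simp: norm_positive_def)
  moreover have "norm ((r * s) *\<^sub>R 1 - r *\<^sub>R a) = r * norm (s *\<^sub>R 1 - a)"
    using assms(2) by (simp add: scaleR_scaleR[symmetric] scaleR_diff_right[symmetric] del: scaleR_scaleR)
  ultimately show ?thesis
    using assms(2) by (auto simp: norm_positive_def intro!: exI[of _ "r * s"] mult_left_mono)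
qed

text \<open>
  Take commuting square roots \<open>x\<close> of \<open>h\<close> and \<open>y\<close> of \<open>-h\<close>; then \<open>\<parallel>x\<^sup>2\<parallel> \<le> \<parallel>x\<^sup>2 + y\<^sup>2\<parallel> = 0\<close>.
\<close>

lemma norm_positive_antisym:
  assumes "norm_positive h" "norm_positive (- h)"
  shows "h = 0"
proof -
  obtain x where x: "norm_positive x" "x * x = h" "\<And>b. b * h = h * b \<Longrightarrow> b * x = x * b"
    using norm_positive_sqrt[OF assms(1)] by metis
  obtain y where y: "norm_positive y" "y * y = - h" using norm_positive_sqrt[OF assms(2)] by metis
  then have "h = - (y * y)" by simp
  then have "y * h = h * y" by (simp add: mult.assoc)
  then have "y * x = x * y" by (rule x(3))
  then have "norm (x * x) \<le> norm (x * x + y * y)"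
    by (intro norm_square_le_commuting norm_positive_selfadjoint x(1) y(1)) simp
  then show ?thesis using x(2) y(2) by simp
qed

text \<open>
  An exponential that stays below a linear function cannot grow. Only exponents \<open>2\<^sup>m\<close> are
  required, as these are the ones for which the norm of a selfadjoint power is known.
\<close>

lemma le_one_if_power_two_linear:
  fixes y :: real
  assumes "\<And>m. y ^ 2 ^ m \<le> 1 + C * 2 ^ m"
  shows "y \<le> 1"
proof (rule ccontr)
  assume "\<not> y \<le> 1"
  then have y: "y > 1" by simp
  have lim0: "(\<lambda>n. (1 / y) ^ n) \<longlonglongrightarrow> 0" using y by (intro LIMSEQ_power_zero) simp
  have lim1: "(\<lambda>n. of_nat n * (1 / y) ^ n) \<longlonglongrightarrow> 0"
    using y by (intro powser_times_n_limit_0) simp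
  have "(\<lambda>n. (1 / y) ^ n + C * (of_nat n * (1 / y) ^ n)) \<longlonglongrightarrow> 0 + C * 0"
    by (intro tendsto_intros lim0 lim1)
  moreover have "strict_mono (\<lambda>m::nat. (2::nat) ^ m)" by (simp add: strict_mono_def)
  ultimately have "(\<lambda>m. (1 / y) ^ (2 ^ m) + C * (of_nat (2 ^ m) * (1 / y) ^ (2 ^ m))) \<longlonglongrightarrow> 0"
    using LIMSEQ_subseq_LIMSEQ[of _ 0 "\<lambda>m::nat. (2::nat) ^ m"] by (force simp: o_def)
  moreover have "1 \<le> (1 / y) ^ (2 ^ m) + C * (of_nat (2 ^ m) * (1 / y) ^ (2 ^ m))" for m
    using assms[of m] y by (simp add: power_one_over field_simps)
  ultimately have "(1::real) \<le> 0" by (intro LIMSEQ_le_const) auto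
  then show False by simp
qed

text \<open>
  This replaces the fact that \<open>b b\<^sup>*\<close> and \<open>b\<^sup>*b\<close> have the same nonzero spectrum. For every polynomial
  \<open>f\<close>, \<open>f(b\<^sup>*b) = f(0) + b\<^sup>* g(b b\<^sup>*) b\<close> with \<open>g(x) = (f(x) - f(0)) / x\<close>. For \<open>f(x) = (s - x)\<^sup>n\<close>, the norm of
  \<open>g(b b\<^sup>*)\<close> is at most \<open>n s\<^sup>n\<^sup>-\<^sup>1\<close>, so \<open>(\<parallel>s - b\<^sup>*b\<parallel> / s)\<^sup>n\<close> grows at most linearly in \<open>n\<close>.
\<close>

lemma norm_positive_swap:
  assumes "norm_positive (b * star b)"
  shows "norm_positive (star b * b)"
proof -
  define u v where "u = star b * b" and "v = b * star b"
  \<comment> \<open>The summand \<open>1\<close> allows division by \<open>s\<close> even if \<open>v = 0\<close>.\<close>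
  define s where "s = norm v + 1"
  have s: "s > 0" by (simp add: s_def add_nonneg_pos)
  have v: "norm (s *\<^sub>R 1 - v) \<le> s"
    using assms by (intro norm_positive_norm_diff_le) (auto simp: v_def s_def)
  \<comment> \<open>\<open>G\<close> is \<open>- g(v)\<close> for the polynomial \<open>g\<close> above.\<close>
  have "\<exists>G. (s *\<^sub>R 1 - u) ^ n = s ^ n *\<^sub>R 1 - star b * G * b \<and> s * norm G \<le> real n * s ^ n" for n
  proof (induction n)
    case (Suc n)
    then obtain G where G: "(s *\<^sub>R 1 - u) ^ n = s ^ n *\<^sub>R 1 - star b * G * b" "s * norm G \<le> real n * s ^ n"
      by blast
    let ?G = "s ^ n *\<^sub>R 1 + G * (s *\<^sub>R 1 - v)"
    have "(s *\<^sub>R 1 - u) ^ Suc n = (s ^ n *\<^sub>R 1 - star b * G * b) * (s *\<^sub>R 1 - u)"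
      by (simp only: power_Suc2 G(1))
    also have "\<dots> = s ^ Suc n *\<^sub>R 1 - star b * ?G * b"
      by (simp add: u_def v_def algebra_simps)
    finally have 1: "(s *\<^sub>R 1 - u) ^ Suc n = s ^ Suc n *\<^sub>R 1 - star b * ?G * b" .
    have "norm ?G \<le> s ^ n * norm (1::'a) + norm G * norm (s *\<^sub>R 1 - v)"
      using norm_triangle_ineq[of "s ^ n *\<^sub>R 1" "G * (s *\<^sub>R 1 - v)"] norm_mult_ineq[of G "s *\<^sub>R 1 - v"] s
      by simp
    also have "\<dots> \<le> s ^ n * 1 + norm G * s"
      by (intro add_mono mult_left_mono v norm_one_le) (use s in auto)
    finally have "s * norm ?G \<le> s * (s ^ n + norm G * s)" using s by simp
    also have "\<dots> = s ^ Suc n + s * (s * norm G)" by (simp add: algebra_simps)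
    also have "\<dots> \<le> s ^ Suc n + s * (real n * s ^ n)"
      using G(2) s by simp
    finally have "s * norm ?G \<le> real (Suc n) * s ^ Suc n" by (simp add: algebra_simps)
    with 1 show ?case by blast
  qed (auto intro!: exI[of _ 0])
  then obtain G where G: "\<And>n. (s *\<^sub>R 1 - u) ^ n = s ^ n *\<^sub>R 1 - star b * G n * b"
      "\<And>n. s * norm (G n) \<le> real n * s ^ n" by metis
  have sa: "star (s *\<^sub>R 1 - u) = s *\<^sub>R 1 - u"
    by (simp add: star_diff u_def star_mult)
  have "norm (s *\<^sub>R 1 - u) / s \<le> 1"
  proof (rule le_one_if_power_two_linear)
    fix m :: nat
    let ?n = "2 ^ m :: nat"
    have "norm (s *\<^sub>R 1 - u) ^ ?n = norm ((s *\<^sub>R 1 - u) ^ ?n)"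
      by (rule norm_selfadjoint_power_two[OF sa, symmetric])
    also have "\<dots> \<le> norm (s ^ ?n *\<^sub>R (1::'a)) + norm (star b * G ?n * b)"
      unfolding G(1) by (rule norm_triangle_ineq4)
    also have "\<dots> \<le> s ^ ?n + norm b ^ 2 * norm (G ?n)"
    proof (rule add_mono)
      show "norm (s ^ ?n *\<^sub>R (1::'a)) \<le> s ^ ?n" using s norm_one_le by (simp add: mult_left_le)
      have "norm (star b * G ?n * b) \<le> norm (star b) * norm (G ?n) * norm b"
        by (rule order_trans[OF norm_mult_ineq mult_right_mono[OF norm_mult_ineq]]) simp
      then show "norm (star b * G ?n * b) \<le> norm b ^ 2 * norm (G ?n)"
        by (simp add: power2_eq_square mult_ac)
    qed
    also have "norm b ^ 2 * norm (G ?n) = norm b ^ 2 / s * (s * norm (G ?n))" using s by simp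
    also have "\<dots> \<le> norm b ^ 2 / s * (real ?n * s ^ ?n)"
      by (rule mult_left_mono[OF G(2)]) (use s in auto)
    finally show "(norm (s *\<^sub>R 1 - u) / s) ^ ?n \<le> 1 + norm b ^ 2 / s * 2 ^ m"
      using s by (simp add: power_divide field_simps)
  qed
  then have "norm (s *\<^sub>R 1 - u) \<le> s" using s by simp
  then show ?thesis
    unfolding norm_positive_def u_def[symmetric] using s sa
    by (auto simp: u_def star_mult intro!: exI[of _ s])
qed

text \<open>
  Kaplansky's argument. Let \<open>h = a\<^sup>*a\<close>, \<open>k = |h|\<close> and \<open>q = k - h\<close>, twice the negative part of \<open>h\<close>. For
  \<open>b = a q\<close>, the product \<open>b\<^sup>*b = q h q = - q\<^sup>2 k\<close> is the negative of a square. Since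
  \<open>b\<^sup>*b + b b\<^sup>* = 2 x\<^sup>2 + 2 y\<^sup>2\<close> for the real and imaginary parts \<open>x, y\<close> of \<open>b\<close>, it follows that \<open>b b\<^sup>*\<close>, hence
  \<open>b\<^sup>*b\<close>, is positive as well. So \<open>b\<^sup>*b = 0\<close>, which forces \<open>q = 0\<close>, that is \<open>h = |h|\<close>.
\<close>

lemma norm_positive_star_mult:
  fixes a :: "'a::unital_cstar_algebra"
  shows "norm_positive (star a * a)"
proof -
  define h where "h = star a * a"
  have h: "star h = h" by (simp add: h_def star_mult)
  \<comment> \<open>\<open>k\<close> is the absolute value of \<open>h\<close>.\<close>
  obtain k where k: "norm_positive k" "k * k = h * h" "\<And>b. b * (h * h) = (h * h) * b \<Longrightarrow> b * k = k * b"
    using norm_positive_sqrt[OF norm_positive_square[OF h]] by metis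
  have hk: "h * k = k * h" by (rule k(3)) (simp only: mult.assoc)
  obtain s where s: "norm_positive s" "s * s = k" "\<And>b. b * k = k * b \<Longrightarrow> b * s = s * b"
    using norm_positive_sqrt[OF k(1)] by metis
  define q where "q = k - h"
  have q: "star q = q" using h norm_positive_selfadjoint[OF k(1)] by (simp add: q_def star_diff)
  have qk: "q * k = k * q" by (simp add: q_def distrib_left left_diff_distrib right_diff_distrib hk mult.assoc)
  have qs: "q * s = s * q" by (rule s(3)[OF qk])
  have hq: "h * q = q * h" by (simp add: q_def distrib_left left_diff_distrib right_diff_distrib hk mult.assoc)
  have qqk: "q * q * k = - (q * h * q)"
  proof -
    have "(k - h) * (k + h) = 0" by (simp add: distrib_left left_diff_distrib k(2) hk)
    then have "q * (q * (k + h)) = 0" by (simp only: q_def mult_zero_right)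
    then show ?thesis by (simp add: distrib_left hq mult.assoc eq_neg_iff_add_eq_0)
  qed
  define b where "b = a * q"
  have bb: "star b * b = q * h * q" by (simp add: b_def star_mult q h_def mult.assoc)
  define c where "c = q * s"
  have c: "star c = c"
    using norm_positive_selfadjoint[OF s(1)] by (simp add: c_def star_mult q qs)
  have cc: "c * c = - (star b * b)"
  proof -
    have "c * c = q * (s * q) * s" by (simp add: c_def mult.assoc)
    also have "\<dots> = q * q * (s * s)" by (simp add: qs[symmetric] mult.assoc)
    finally show ?thesis by (simp add: s(2) qqk bb)
  qed
  define x y where "x = (1 / 2) *\<^sub>R (b + star b)" and "y = (- \<i> / 2) *\<^sub>C (b - star b)"
  have x: "star x = x" by (simp add: x_def star_add add.commute)
  have y: "star y = y"
    by (simp add: y_def star_scaleC star_diff scaleC_diff_right scaleC_minus_left)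
  have "4 *\<^sub>R (x * x) + 4 *\<^sub>R (y * y) = 2 *\<^sub>R (star b * b + b * star b)"
  proof -
    have "4 *\<^sub>R (x * x) = (b + star b) * (b + star b)" by (simp add: x_def)
    moreover have "4 *\<^sub>R (y * y) = - ((b - star b) * (b - star b))"
      by (simp add: y_def mult_scaleC_left mult_scaleC_right scaleC_scaleC scaleC_of_real[symmetric])
    ultimately show ?thesis by (simp add: algebra_simps scaleR_2)
  qed
  then have "2 *\<^sub>R (b * star b) = 4 *\<^sub>R (x * x) + 4 *\<^sub>R (y * y) + 2 *\<^sub>R (c * c)"
    by (simp add: cc algebra_simps)
  then have "b * star b = (1/2) *\<^sub>R (4 *\<^sub>R (x * x) + 4 *\<^sub>R (y * y) + 2 *\<^sub>R (c * c))"
    by (simp flip: \<open>2 *\<^sub>R (b * star b) = _\<close>)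
  also have "norm_positive \<dots>"
    by (intro norm_positive_scaleR norm_positive_add norm_positive_square x y c) auto
  finally have "norm_positive (star b * b)" by (rule norm_positive_swap)
  moreover have "norm_positive (- (star b * b))"
    using norm_positive_square[OF c] cc by simp
  ultimately have "star b * b = 0" by (rule norm_positive_antisym)
  then have 0: "q * h * q = 0" "q * q * k = 0" using bb qqk by simp_all
  have "q * q * q = q * q * (k - h)" by (simp only: q_def)
  also have "\<dots> = q * q * k - q * h * q"
    by (simp only: right_diff_distrib mult.assoc hq)
  finally have "q * q * q = q * q * k - q * h * q" .
  then have "(q * q) * (q * q) = 0" using 0 by (simp add: mult.assoc[symmetric])
  then have "norm (q * q) ^ 2 = 0"
    using norm_selfadjoint_square[of "q * q"] q by (simp add: star_mult)
  then have "norm q ^ 2 = 0" using norm_selfadjoint_square[OF q] by simp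
  then have "h = k" by (simp add: q_def)
  then show ?thesis using k(1) h_def by simp
qed

lemma cstar_positive_iff_norm_positive: "cstar_positive a \<longleftrightarrow> norm_positive a"
  unfolding cstar_positive_def
  by (metis norm_positive_star_mult norm_positive_sqrt norm_positive_selfadjoint)

lemma cstar_positive_star_mult: "cstar_positive (star a * a)"
  by (auto simp: cstar_positive_def)

lemma cstar_positive_selfadjoint: "cstar_positive a \<Longrightarrow> star a = a"
  by (auto simp: cstar_positive_def star_mult)

lemma cstar_positive_add: "cstar_positive a \<Longrightarrow> cstar_positive b \<Longrightarrow> cstar_positive (a + b)"
  by (simp add: cstar_positive_iff_norm_positive norm_positive_add)

lemma cstar_positive_zero [simp]: "cstar_positive 0"
  using cstar_positive_star_mult[of 0] by simp

lemma cstar_positive_scaleR: "cstar_positive a \<Longrightarrow> r \<ge> 0 \<Longrightarrow> cstar_positive (r *\<^sub>R a)"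
  by (simp add: cstar_positive_iff_norm_positive norm_positive_scaleR)

lemma cstar_positive_sum: "(\<And>i. i \<in> I \<Longrightarrow> cstar_positive (f i)) \<Longrightarrow> cstar_positive (sum f I)"
  by (induction I rule: infinite_finite_induct) (auto intro: cstar_positive_add)

lemma cstar_positive_conj: "cstar_positive a \<Longrightarrow> cstar_positive (star c * a * c)"
  using cstar_positive_star_mult[of "b * c" for b]
  by (auto simp: cstar_positive_def star_mult mult.assoc)

lemma cstar_positive_norm_diff:
  assumes "star a = a" "norm a \<le> t"
  shows "cstar_positive (t *\<^sub>R 1 - a)"
  unfolding cstar_positive_iff_norm_positive norm_positive_def
  using assms by (auto simp: star_diff intro!: exI[of _ t] order_trans[OF norm_ge_zero])

text \<open>
  For positive elements the constant \<open>t\<close> of \<open>norm_positive\<close> may be chosen as the norm, and the resulting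
  condition is closed.
\<close>

lemma cstar_positive_limit:
  assumes lim: "(f \<longlongrightarrow> a) F" and F: "F \<noteq> bot" and pos: "\<And>n. cstar_positive (f n)"
  shows "cstar_positive a"
proof -
  have "((\<lambda>n. star (f n)) \<longlongrightarrow> star a) F" by (rule tendsto_star[OF lim])
  then have sa: "star a = a"
    using lim F tendsto_unique cstar_positive_selfadjoint[OF pos] by fastforce
  have l1: "((\<lambda>n. norm (norm (f n) *\<^sub>R 1 - f n)) \<longlongrightarrow> norm (norm a *\<^sub>R 1 - a)) F"
    and l2: "((\<lambda>n. norm (f n)) \<longlongrightarrow> norm a) F"
    by (intro tendsto_intros lim)+
  have "norm (norm (f n) *\<^sub>R 1 - f n) \<le> norm (f n)" for n
    using pos[of n] norm_positive_norm_diff_le by (auto simp: cstar_positive_iff_norm_positive)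
  then have "norm (norm a *\<^sub>R 1 - a) \<le> norm a"
    by (intro tendsto_le[OF F l2 l1]) simp
  then show ?thesis
    unfolding cstar_positive_iff_norm_positive norm_positive_def using sa by (auto intro!: exI[of _ "norm a"])
qed

text \<open>
  With \<open>t = \<parallel>b\<parallel>\<close>, both \<open>a\<close> and \<open>t - a = (t - b) + (b - a)\<close> are positive; their commuting square roots
  \<open>x, y\<close> give \<open>\<parallel>a\<parallel> = \<parallel>x\<^sup>2\<parallel> \<le> \<parallel>x\<^sup>2 + y\<^sup>2\<parallel> \<le> t\<close>.
\<close>

lemma cstar_positive_norm_mono:
  assumes "cstar_positive a" "cstar_positive (b - a)"
  shows "norm a \<le> norm b"
proof -
  let ?t = "norm b"
  have "star b = b"
    using cstar_positive_selfadjoint[OF cstar_positive_add[OF assms]] by simp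
  then have "cstar_positive ((?t *\<^sub>R 1 - b) + (b - a))"
    by (intro cstar_positive_add cstar_positive_norm_diff assms) auto
  then have 1: "norm_positive (?t *\<^sub>R 1 - a)" by (simp add: cstar_positive_iff_norm_positive)
  have 2: "norm_positive a" using assms(1) by (simp add: cstar_positive_iff_norm_positive)
  obtain x where x: "norm_positive x" "x * x = a" "\<And>c. c * a = a * c \<Longrightarrow> c * x = x * c"
    using norm_positive_sqrt[OF 2] by metis
  obtain y where y: "norm_positive y" "y * y = ?t *\<^sub>R 1 - a" using norm_positive_sqrt[OF 1] by metis
  then have a: "a = ?t *\<^sub>R 1 - y * y" by simp
  have "y * a = a * y" unfolding a by (simp add: algebra_simps)
  then have "y * x = x * y" by (rule x(3))
  then have "norm (x * x) \<le> norm (x * x + y * y)"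
    by (intro norm_square_le_commuting norm_positive_selfadjoint x(1) y(1)) simp
  also have "\<dots> \<le> ?t" using norm_one_le[where 'a='a] by (simp add: x(2) y(2) mult_left_le)
  finally show ?thesis by (simp add: x(2))
qed

text \<open>
  Here \<open>p, q, r\<close> stand for \<open>\<langle>x, x\<rangle>, \<langle>x, y\<rangle>, \<langle>y, y\<rangle>\<close>, and the hypothesis for \<open>\<langle>x a - y, x a - y\<rangle> \<ge> 0\<close>.
  Stated for elements of \<open>A\<close>, the inequality serves both matrices and kernels. The proof takes
  \<open>a = q / t\<close> with \<open>t > \<parallel>p\<parallel>\<close> and lets \<open>t\<close> tend to \<open>\<parallel>p\<parallel>\<close>.
\<close>

lemma cstar_Cauchy_Schwarz:
  assumes pos: "\<And>a. cstar_positive (star a * p * a - star a * q - star q * a + r)"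
    and p: "cstar_positive p"
  shows "norm q ^ 2 \<le> norm p * norm r"
proof -
  have r: "cstar_positive r" using pos[of 0] by simp
  have *: "norm q ^ 2 \<le> t * norm r" if t: "norm p < t" for t
  proof -
    have t0: "t > 0" using t norm_ge_zero[of p] by linarith
    have "cstar_positive (star ((1 / t) *\<^sub>R q) * (t *\<^sub>R 1 - p) * ((1 / t) *\<^sub>R q))"
      using t by (intro cstar_positive_conj cstar_positive_norm_diff cstar_positive_selfadjoint p) auto
    from cstar_positive_add[OF this pos[of "(1 / t) *\<^sub>R q"]]
    have "cstar_positive (r - (1 / t) *\<^sub>R (star q * q))"
      using t0 by (simp add: algebra_simps)
    then have "norm ((1 / t) *\<^sub>R (star q * q)) \<le> norm r"
      using t0 by (intro cstar_positive_norm_mono cstar_positive_scaleR cstar_positive_star_mult) auto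
    then show ?thesis using t0 by (simp add: cstar_identity field_simps)
  qed
  show ?thesis
  proof (rule field_le_epsilon)
    fix e :: real assume e: "e > 0"
    have "norm q ^ 2 \<le> (norm p + e / (norm r + 1)) * norm r"
      by (rule *) (use e norm_ge_zero[of r] in \<open>auto intro!: divide_pos_pos add_nonneg_pos\<close>)
    also have "e / (norm r + 1) * norm r \<le> e"
      using e norm_ge_zero[of r] by (simp add: divide_le_eq add_nonneg_pos algebra_simps not_less)
    then have "(norm p + e / (norm r + 1)) * norm r \<le> norm p * norm r + e"
      by (simp add: distrib_right)
    finally show "norm q ^ 2 \<le> norm p * norm r + e" .
  qed
qed

section \<open>Positive matrices\<close>

lemma matrix_positiveD:
  fixes M :: "nat \<Rightarrow> nat \<Rightarrow> 'a::unital_cstar_algebra"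
  assumes "matrix_positive n M"
  shows "cstar_positive (\<Sum>i<n. \<Sum>j<n. star (a i) * M i j * a j)"
proof -
  from assms obtain N where N: "\<And>i j. i < n \<Longrightarrow> j < n \<Longrightarrow> M i j = (\<Sum>k<n. star (N k i) * N k j)"
    by (auto simp: matrix_positive_def)
  have "(\<Sum>i<n. \<Sum>j<n. star (a i) * M i j * a j) =
      (\<Sum>i<n. \<Sum>j<n. \<Sum>k<n. star (N k i * a i) * (N k j * a j))"
    by (intro sum.cong refl) (simp add: N star_mult sum_distrib_left sum_distrib_right mult.assoc)
  also have "\<dots> = (\<Sum>k<n. \<Sum>i<n. \<Sum>j<n. star (N k i * a i) * (N k j * a j))"
    by (subst (2) sum.swap, subst sum.swap) (rule refl)
  also have "\<dots> = (\<Sum>k<n. star (\<Sum>i<n. N k i * a i) * (\<Sum>j<n. N k j * a j))"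
    by (simp add: star_sum sum_product)
  also have "cstar_positive \<dots>"
    by (intro cstar_positive_sum cstar_positive_star_mult)
  finally show ?thesis .
qed

text \<open>
  For \<open>c > 0\<close> and \<open>z = c\<^sup>1\<^sup>/\<^sup>2 x - c\<^sup>-\<^sup>1\<^sup>/\<^sup>2 m y\<close>, the element is \<open>z\<^sup>*z + y\<^sup>*(c - m\<^sup>*m / c) y\<close>. Summed over the entries of
  a matrix, this bounds the matrix from above by a multiple of the identity.
\<close>

lemma cstar_positive_cross:
  fixes x y m :: "'a::unital_cstar_algebra"
  assumes "norm m \<le> c"
  shows "cstar_positive (c *\<^sub>R (star x * x + star y * y) - (star x * m * y + star y * star m * x))"
proof (cases "c > 0")
  case True
  let ?z = "sqrt c *\<^sub>R x - (1 / sqrt c) *\<^sub>R (m * y)"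
  have "norm ((1 / c) *\<^sub>R (star m * m)) = norm m * norm m / c"
    using True by (simp add: cstar_identity power2_eq_square)
  also have "\<dots> \<le> c"
    using True assms mult_mono[OF assms assms] by (simp add: divide_le_eq)
  finally have "cstar_positive (c *\<^sub>R 1 - (1 / c) *\<^sub>R (star m * m))"
    by (intro cstar_positive_norm_diff) (simp_all add: star_mult)
  then have "cstar_positive (star ?z * ?z + star y * (c *\<^sub>R 1 - (1 / c) *\<^sub>R (star m * m)) * y)"
    by (intro cstar_positive_add cstar_positive_star_mult cstar_positive_conj)
  also have "star ?z * ?z + star y * (c *\<^sub>R 1 - (1 / c) *\<^sub>R (star m * m)) * y =
      c *\<^sub>R (star x * x + star y * y) - (star x * m * y + star y * star m * x)"
    using True by (simp add: star_diff star_mult algebra_simps)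
  finally show ?thesis .
next
  case False
  with assms norm_ge_zero[of m] have "c = 0" "norm m = 0" by linarith+
  then show ?thesis by simp
qed

definition matrix_form ::
    "nat \<Rightarrow> (nat \<Rightarrow> nat \<Rightarrow> 'a) \<Rightarrow> (nat \<Rightarrow> 'a) \<Rightarrow> (nat \<Rightarrow> 'a) \<Rightarrow> 'a::unital_cstar_algebra" where
  "matrix_form n M a b = (\<Sum>i<n. \<Sum>j<n. star (a i) * M i j * b j)"

lemma matrix_form_Cauchy_Schwarz:
  fixes M :: "nat \<Rightarrow> nat \<Rightarrow> 'a::unital_cstar_algebra"
  assumes herm: "\<And>i j. i < n \<Longrightarrow> j < n \<Longrightarrow> M j i = star (M i j)"
    and pos: "\<And>a. cstar_positive (matrix_form n M a a)"
  shows "norm (matrix_form n M x y) ^ 2 \<le> norm (matrix_form n M x x) * norm (matrix_form n M y y)"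
proof (rule cstar_Cauchy_Schwarz[OF _ pos])
  fix a
  have star_form: "star (matrix_form n M x y) = matrix_form n M y x"
    unfolding matrix_form_def
    by (subst (2) sum.swap) (simp add: star_sum star_mult herm[symmetric] mult.assoc)
  have "matrix_form n M (\<lambda>i. x i * a - y i) (\<lambda>i. x i * a - y i) =
    star a * matrix_form n M x x * a - star a * matrix_form n M x y
      - matrix_form n M y x * a + matrix_form n M y y"
    unfolding matrix_form_def
    by (simp add: star_diff star_mult algebra_simps sum_subtractf sum.distrib sum_distrib_left sum_distrib_right)
  then show "cstar_positive (star a * matrix_form n M x x * a - star a * matrix_form n M x y
      - star (matrix_form n M x y) * a + matrix_form n M y y)"
    using pos[of "\<lambda>i. x i * a - y i"] by (simp add: star_form)
qed

primrec matrix_pow :: "nat \<Rightarrow> (nat \<Rightarrow> nat \<Rightarrow> 'a) \<Rightarrow> nat \<Rightarrow> nat \<Rightarrow> nat \<Rightarrow> 'a::unital_cstar_algebra" where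
  "matrix_pow n T 0 i j = (if i = j then 1 else 0)"
| "matrix_pow n T (Suc k) i j = (\<Sum>l<n. T i l * matrix_pow n T k l j)"

lemma matrix_pow_1: "j < n \<Longrightarrow> matrix_pow n T (Suc 0) i j = T i j"
  by (simp add: if_distrib[of "\<lambda>x. _ * x"] cong: if_cong)

lemma matrix_pow_add:
  "i < n \<Longrightarrow> j < n \<Longrightarrow> matrix_pow n T (p + q) i j = (\<Sum>l<n. matrix_pow n T p i l * matrix_pow n T q l j)"
proof (induction p arbitrary: i)
  case 0
  then show ?case by (simp add: if_distrib[of "\<lambda>x. x * _"] cong: if_cong)
next
  case (Suc p)
  have "matrix_pow n T (Suc p + q) i j =
      (\<Sum>l<n. \<Sum>m<n. T i l * (matrix_pow n T p l m * matrix_pow n T q m j))"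
    using Suc by (simp add: sum_distrib_left)
  also have "\<dots> = (\<Sum>l<n. matrix_pow n T (Suc p) i l * matrix_pow n T q l j)"
    by (subst sum.swap) (simp add: sum_distrib_right mult.assoc)
  finally show ?case .
qed

lemma matrix_pow_star:
  assumes "\<And>i j. i < n \<Longrightarrow> j < n \<Longrightarrow> T j i = star (T i j)"
  shows "i < n \<Longrightarrow> j < n \<Longrightarrow> star (matrix_pow n T k i j) = matrix_pow n T k j i"
proof (induction k arbitrary: i j)
  case (Suc k)
  have "star (matrix_pow n T (Suc k) i j) = (\<Sum>l<n. matrix_pow n T k j l * matrix_pow n T (Suc 0) l i)"
    using Suc assms[symmetric] by (simp add: star_sum star_mult matrix_pow_1 del: matrix_pow.simps(2))
      (simp add: star_sum star_mult)
  also have "\<dots> = matrix_pow n T (Suc k) j i"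
    using matrix_pow_add[of j n i T k "Suc 0"] Suc by simp
  finally show ?case .
qed simp

text \<open>
  Scale \<open>M\<close> to \<open>1 - T\<close> with \<open>0 \<le> T \<le> 1\<close> as quadratic forms on \<open>A\<^sup>n\<close>. By the Cauchy-Schwarz inequality for
  the form of \<open>T\<close>, \<open>T\<close> is a contraction of \<open>A\<^sup>n\<close>, so the entries of all its powers have norm at most
  \<open>1\<close>. The square root series therefore converges entry by entry and gives a selfadjoint \<open>S\<close> with
  \<open>S\<^sup>2 = 1 - T\<close>, and \<open>M\<close> is the square of a multiple of \<open>S\<close>.
\<close>

lemma matrix_positiveI:
  fixes M :: "nat \<Rightarrow> nat \<Rightarrow> 'a::unital_cstar_algebra"
  assumes herm: "\<And>i j. i < n \<Longrightarrow> j < n \<Longrightarrow> M j i = star (M i j)"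
    and pos: "\<And>a. cstar_positive (\<Sum>i<n. \<Sum>j<n. star (a i) * M i j * a j)"
  shows "matrix_positive n M"
proof -
  define c where "c = (\<Sum>i<n. \<Sum>j<n. norm (M i j))"
  \<comment> \<open>\<open>M \<le> n c\<close>; adding \<open>1\<close> makes \<open>t\<close> positive even if \<open>M = 0\<close>.\<close>
  define t where "t = real n * c + 1"
  have c0: "c \<ge> 0" unfolding c_def by (intro sum_nonneg) auto
  have t: "t > 0" unfolding t_def using c0 by (simp add: add_nonneg_pos)
  have Mc: "norm (M i j) \<le> c" if "i < n" "j < n" for i j
  proof -
    have "norm (M i j) \<le> (\<Sum>j<n. norm (M i j))" using that by (intro member_le_sum) auto
    also have "\<dots> \<le> c" unfolding c_def
      using that by (intro member_le_sum[of i "{..<n}" "\<lambda>i. \<Sum>j<n. norm (M i j)"]) (auto intro: sum_nonneg)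
    finally show ?thesis .
  qed
  define T where "T i j = (if i = j then 1 else 0) - (1 / t) *\<^sub>R M i j" for i j
  have Therm: "T j i = star (T i j)" if "i < n" "j < n" for i j
    using herm[OF that] by (simp add: T_def star_diff)
  have form_T: "matrix_form n T a b = (\<Sum>i<n. star (a i) * b i) - (1 / t) *\<^sub>R matrix_form n M a b" for a b
    unfolding matrix_form_def T_def
    by (simp add: right_diff_distrib left_diff_distrib sum_subtractf scaleR_sum_right
        if_distrib[of "\<lambda>x. _ * x"] if_distrib[of "\<lambda>x. x * _"] cong: if_cong)
  have upper: "cstar_positive ((\<Sum>i<n. star (a i) * a i) - matrix_form n T a a)" for a
    unfolding form_T using pos[of a] t by (simp add: matrix_form_def cstar_positive_scaleR)
  have lower: "cstar_positive (matrix_form n T a a)" for a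
  proof -
    have "cstar_positive (\<Sum>i<n. \<Sum>j<n. c *\<^sub>R (star (a i) * a i + star (a j) * a j)
        - (star (a i) * M i j * a j + star (a j) * star (M i j) * a i))"
      by (intro cstar_positive_sum cstar_positive_cross Mc) auto
    also have "(\<Sum>i<n. \<Sum>j<n. c *\<^sub>R (star (a i) * a i + star (a j) * a j)
        - (star (a i) * M i j * a j + star (a j) * star (M i j) * a i)) =
      (2 * real n * c) *\<^sub>R (\<Sum>i<n. star (a i) * a i) - 2 *\<^sub>R matrix_form n M a a" (is "?S = _")
    proof -
      have 1: "(\<Sum>i<n. \<Sum>j<n. star (a j) * star (M i j) * a i) = matrix_form n M a a"
        unfolding matrix_form_def by (subst sum.swap) (simp add: herm[symmetric])
      have "?S = c *\<^sub>R (\<Sum>i<n. \<Sum>j<n. star (a i) * a i) + c *\<^sub>R (\<Sum>i<n. \<Sum>j<n. star (a j) * a j)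
          - (matrix_form n M a a + (\<Sum>i<n. \<Sum>j<n. star (a j) * star (M i j) * a i))"
        by (simp only: matrix_form_def sum_subtractf sum.distrib scaleR_add_right scaleR_sum_right)
      then show ?thesis unfolding 1
        by (simp add: sum_constant_scaleR scaleR_2 scaleR_sum_right[symmetric] scaleR_add_left[symmetric])
    qed
    finally have "cstar_positive ((1 / (2 * t)) *\<^sub>R
        ((2 * real n * c) *\<^sub>R (\<Sum>i<n. star (a i) * a i) - 2 *\<^sub>R matrix_form n M a a)
        + (1 / t) *\<^sub>R (\<Sum>i<n. star (a i) * a i))"
      using t by (intro cstar_positive_add cstar_positive_scaleR cstar_positive_sum cstar_positive_star_mult) auto
    also have "(1 / (2 * t)) *\<^sub>R ((2 * real n * c) *\<^sub>R (\<Sum>i<n. star (a i) * a i) - 2 *\<^sub>R matrix_form n M a a)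
        + (1 / t) *\<^sub>R (\<Sum>i<n. star (a i) * a i) =
      (real n * c / t + 1 / t) *\<^sub>R (\<Sum>i<n. star (a i) * a i) - (1 / t) *\<^sub>R matrix_form n M a a"
      by (simp add: scaleR_diff_right scaleR_add_left)
    also have "real n * c / t + 1 / t = 1" using t by (simp add: add_divide_distrib[symmetric] t_def)
    finally show ?thesis by (simp add: form_T)
  qed
  have contraction: "norm (\<Sum>i<n. star (\<Sum>j<n. T i j * b j) * (\<Sum>j<n. T i j * b j)) \<le> norm (\<Sum>i<n. star (b i) * b i)" for b
  proof -
    let ?a = "\<lambda>i. \<Sum>j<n. T i j * b j"
    let ?p = "norm (\<Sum>i<n. star (?a i) * ?a i)"
    have le: "norm (matrix_form n T x x) \<le> norm (\<Sum>i<n. star (x i) * x i)" for x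
      by (rule cstar_positive_norm_mono[OF lower upper])
    have "matrix_form n T ?a b = (\<Sum>i<n. star (?a i) * ?a i)"
      unfolding matrix_form_def by (simp only: sum_distrib_left mult.assoc)
    \<comment> \<open>The form of \<open>T\<close> at \<open>T b\<close> and \<open>b\<close> is \<open>\<langle>T b, T b\<rangle>\<close>.\<close>
    then have "?p ^ 2 \<le> norm (matrix_form n T ?a ?a) * norm (matrix_form n T b b)"
      using matrix_form_Cauchy_Schwarz[OF Therm lower, of ?a b] by simp
    also have "\<dots> \<le> ?p * norm (\<Sum>i<n. star (b i) * b i)"
      by (intro mult_mono le) auto
    finally have "?p * ?p \<le> ?p * norm (\<Sum>i<n. star (b i) * b i)" by (simp add: power2_eq_square)
    then show ?thesis by (cases "?p = 0") (auto simp: mult_le_cancel_left)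
  qed
  let ?P = "matrix_pow n T"
  have col: "norm (\<Sum>i<n. star (?P k i j) * ?P k i j) \<le> 1" if "j < n" for k j
  proof (induction k)
    case 0
    then show ?case
      using that norm_one_le by (simp add: if_distrib[of "\<lambda>x. _ * x"] if_distrib[of star] cong: if_cong)
  next
    case (Suc k)
    show ?case using order_trans[OF contraction[of "\<lambda>i. ?P k i j"] Suc] by simp
  qed
  have bnd: "norm (?P k i j) \<le> 1" if "i < n" "j < n" for k i j
  proof -
    have "norm (?P k i j) ^ 2 = norm (star (?P k i j) * ?P k i j)" by (simp add: cstar_identity)
    also have "\<dots> \<le> norm (\<Sum>i<n. star (?P k i j) * ?P k i j)"
    proof (rule cstar_positive_norm_mono[OF cstar_positive_star_mult])
      have "(\<Sum>i<n. star (?P k i j) * ?P k i j) - star (?P k i j) * ?P k i j =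
          (\<Sum>i\<in>{..<n} - {i}. star (?P k i j) * ?P k i j)"
        using that by (simp add: sum_diff1)
      then show "cstar_positive ((\<Sum>i<n. star (?P k i j) * ?P k i j) - star (?P k i j) * ?P k i j)"
        by (auto intro!: cstar_positive_sum cstar_positive_star_mult)
    qed
    also have "\<dots> \<le> 1" by (rule col[OF that(2)])
    finally show ?thesis by (simp add: power2_le_iff_abs_le abs_square_le_1)
  qed
  define S where "S i j = sqrt_series (\<lambda>k. ?P k i j)" for i j
  have Sstar: "star (S i j) = S j i" if "i < n" "j < n" for i j
    unfolding S_def
    using sqrt_series_bounded_linear[OF bounded_linear_star bnd[OF that]] that
    by (simp add: matrix_pow_star[OF Therm])
  have SS: "(\<Sum>k<n. S i k * S k j) = (1 / t) *\<^sub>R M i j" if "i < n" "j < n" for i j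
  proof -
    have "(\<Sum>k<n. S i k * S k j) = ?P 0 i j - ?P 1 i j"
      unfolding S_def
      by (rule sqrt_series_square[of n ?P 1]) (use that bnd matrix_pow_add in auto)
    then show ?thesis
      using matrix_pow_1[OF that(2), of T i] by (simp add: T_def del: matrix_pow.simps(2))
  qed
  show ?thesis
    unfolding matrix_positive_def
  proof (intro exI allI impI)
    fix i j assume ij: "i < n" "j < n"
    have "(\<Sum>k<n. star (sqrt t *\<^sub>R S k i) * sqrt t *\<^sub>R S k j) = t *\<^sub>R (\<Sum>k<n. S i k * S k j)"
      unfolding scaleR_sum_right using ij t by (intro sum.cong) (auto simp: Sstar)
    then show "M i j = (\<Sum>k<n. star (sqrt t *\<^sub>R S k i) * sqrt t *\<^sub>R S k j)"
      using t ij by (simp add: SS)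
  qed
qed

section \<open>Coefficients are combinations of positive definite maps\<close>

context hilbert_module
begin

abbreviation ip where "ip \<equiv> inner_prod X"

lemma inner_zero_right: "u \<in> carrier X \<Longrightarrow> ip u \<zero> = 0"
  using inner_add[of u \<zero> \<zero>] by simp

lemma inner_add_left:
  "x \<in> carrier X \<Longrightarrow> y \<in> carrier X \<Longrightarrow> z \<in> carrier X \<Longrightarrow> ip (x \<oplus> y) z = ip x z + ip y z"
  using inner_star[of z "x \<oplus> y"] inner_star[of z x] inner_star[of z y] inner_add[of z x y]
  by (simp add: star_add)

lemma inner_cscale_left:
  "x \<in> carrier X \<Longrightarrow> y \<in> carrier X \<Longrightarrow> ip (cscale X c x) y = cnj c *\<^sub>C ip x y"
  using inner_star[of y "cscale X c x"] inner_star[of y x] inner_cscale[of y x c]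
  by (simp add: star_scaleC cscale_closed)

text \<open>
  The combination \<open>\<Sum> z\<^sub>i a\<^sub>i\<close>, known only through its inner products; this is all that the Gram matrix
  requires.
\<close>

lemma module_combination:
  fixes n :: nat
  assumes "\<And>i. i < n \<Longrightarrow> z i \<in> carrier X"
  shows "\<exists>w\<in>carrier X. \<forall>u\<in>carrier X. ip u w = (\<Sum>i<n. ip u (z i) * a i)"
  using assms
proof (induction n)
  case 0
  then show ?case by (auto intro!: bexI[of _ \<zero>] simp: inner_zero_right)
next
  case (Suc n)
  then obtain w where "w \<in> carrier X" "\<And>u. u \<in> carrier X \<Longrightarrow> ip u w = (\<Sum>i<n. ip u (z i) * a i)"
    by auto
  with Suc.prems[of n] show ?case
    by (intro bexI[of _ "w \<oplus> act X (z n) (a n)"]) (auto simp: inner_add inner_act act_closed)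
qed

lemma Gram_matrix_positive:
  assumes z: "\<And>i. i < n \<Longrightarrow> z i \<in> carrier X"
  shows "matrix_positive n (\<lambda>i j. ip (z i) (z j))"
proof (rule matrix_positiveI)
  show "ip (z j) (z i) = star (ip (z i) (z j))" if "i < n" "j < n" for i j
    using that z by (intro inner_star) auto
  fix a :: "nat \<Rightarrow> 'a"
  obtain w where w: "w \<in> carrier X" "\<And>u. u \<in> carrier X \<Longrightarrow> ip u w = (\<Sum>i<n. ip u (z i) * a i)"
    using module_combination[of n z a] z by auto
  have "(\<Sum>i<n. ip w (z i) * a i) = (\<Sum>i<n. star (ip (z i) w) * a i)"
    using w(1) z by (intro sum.cong arg_cong2[of _ _ _ _ "(*)"] inner_star) auto
  then have "ip w w = star (\<Sum>i<n. star (ip (z i) w) * a i)"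
    using inner_star[OF w(1) w(1)] w by simp
  also have "\<dots> = (\<Sum>i<n. \<Sum>j<n. star (a i) * ip (z i) (z j) * a j)"
    using w z by (simp add: star_sum star_mult sum_distrib_left mult.assoc)
  finally show "cstar_positive (\<Sum>i<n. \<Sum>j<n. star (a i) * ip (z i) (z j) * a j)"
    using inner_positive[OF w(1)] by simp
qed

end

text \<open>
  By the axioms of an equivariant representation, the \<open>(i, j)\<close> entry of the matrix in the definition
  of positive definiteness is \<open>\<langle>\<rho>(a\<^sub>i) v(g\<^sub>i) x, \<rho>(a\<^sub>j) v(g\<^sub>j) x\<rangle>\<close>.
\<close>

lemma coefficient_positive_definite:
  fixes X :: "('a::unital_cstar_algebra, 'x) module_data"
  assumes "twisted_dynamical_system \<alpha> \<sigma>" and "hilbert_module X"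
    and eq: "equivariant_representation \<alpha> \<sigma> X \<rho> v" and x: "x \<in> carrier X"
  shows "coefficient X \<rho> v x x \<in> positive_definite_maps \<alpha> \<sigma>"
proof -
  interpret twisted_dynamical_system \<alpha> \<sigma> by fact
  interpret hilbert_module X by fact
  have rep: "star_representation X \<rho>" and bi: "\<And>g. bounded_invertible X (v g)"
    and i: "\<And>g a x. x \<in> carrier X \<Longrightarrow> \<rho> (\<alpha> g a) x = v g (\<rho> a (inv_into (carrier X) (v g) x))"
    and ii: "\<And>g h x. x \<in> carrier X \<Longrightarrow> v g (v h x) = ad_rep X \<rho> (\<sigma> g h) (v (g + h) x)"
    and iii: "\<And>g x x'. x \<in> carrier X \<Longrightarrow> x' \<in> carrier X \<Longrightarrow> \<alpha> g (ip x x') = ip (v g x) (v g x')"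
    using eq by (auto simp: equivariant_representation_def)
  have adj: "is_adjoint X (\<rho> a) (\<rho> (star a))" for a
    using rep by (auto simp: star_representation_def)
  have rho: "\<rho> a x \<in> carrier X" if "x \<in> carrier X" for a x
    using adj[of a] that by (auto simp: is_adjoint_def)
  have radj: "ip (\<rho> a y) z = ip y (\<rho> (star a) z)" if "y \<in> carrier X" "z \<in> carrier X" for a y z
    using adj[of a] that by (auto simp: is_adjoint_def)
  have v: "v g x \<in> carrier X" if "x \<in> carrier X" for g x
    using bi[of g] that by (auto simp: bounded_invertible_def bij_betw_def)
  have rmult: "\<rho> (a * b) x = \<rho> a (\<rho> b x)" if "x \<in> carrier X" for a b x
    using rep that by (auto simp: star_representation_def)
  have lin: "coefficient X \<rho> v x x \<in> linear_maps"
    using rep v[OF x] rho[OF v[OF x]] x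
    by (auto simp: linear_maps_def coefficient_def star_representation_def inner_add inner_cscale)
  have entry: "\<alpha> g (coefficient X \<rho> v x x (- g + h)
      (inv_into UNIV (\<alpha> g) (star a * b * star (\<sigma> g (- g + h))))) * \<sigma> g (- g + h) =
      ip (\<rho> a (v g x)) (\<rho> b (v h x))" for g h a b
  proof -
    define s where "s = \<sigma> g (- g + h)"
    define c where "c = star a * b * star s"
    define d where "d = inv_into UNIV (\<alpha> g) c"
    have d: "\<alpha> g d = c"
      unfolding d_def using automorphism[of g] by (intro f_inv_into_f) (auto simp: cstar_automorphism_def bij_def)
    have s: "star s * s = 1" using unitary[of g "- g + h"] by (simp add: s_def cstar_unitary_def)
    let ?y = "v (- g + h) x"
    have y: "?y \<in> carrier X" by (rule v[OF x])
    have "\<alpha> g (ip x (\<rho> d ?y)) = ip (v g x) (v g (\<rho> d ?y))"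
      by (rule iii[OF x rho[OF y]])
    also have "v g (\<rho> d ?y) = \<rho> c (v g ?y)"
      using i[OF v[OF y], of g d g] d bi[of g] y by (simp add: bounded_invertible_def bij_betw_def)
    also have "v g ?y = act X (\<rho> s (v h x)) (star s)"
      using ii[OF x, of g "- g + h"] by (simp add: ad_rep_def s_def add.assoc[symmetric])
    \<comment> \<open>\<open>\<rho>(c)\<close> moves to the left factor to let \<open>star s\<close> out on the right.\<close>
    also have "ip (v g x) (\<rho> c (act X (\<rho> s (v h x)) (star s))) =
        ip (\<rho> (star c) (v g x)) (\<rho> s (v h x)) * star s"
      using radj[of "v g x" "act X (\<rho> s (v h x)) (star s)" "star c"]
      by (simp add: inner_act act_closed rho v x)
    also have "\<dots> * s = ip (\<rho> (star c) (v g x)) (\<rho> s (v h x))"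
      by (simp add: mult.assoc s)
    also have "\<dots> = ip (v g x) (\<rho> (c * s) (v h x))"
      using radj[of "v g x" "\<rho> s (v h x)" "star c"] by (simp add: rmult rho v x)
    also have "c * s = star a * b" by (simp add: c_def mult.assoc s)
    also have "ip (v g x) (\<rho> (star a * b) (v h x)) = ip (\<rho> a (v g x)) (\<rho> b (v h x))"
      by (simp add: rmult rho v x radj)
    finally show ?thesis
      by (simp add: coefficient_def d_def c_def s_def)
  qed
  show ?thesis
    unfolding positive_definite_maps_def
  proof (intro CollectI conjI lin allI)
    fix n and g :: "nat \<Rightarrow> 'b" and a :: "nat \<Rightarrow> 'a"
    show "matrix_positive n (\<lambda>i j. \<alpha> (g i) (coefficient X \<rho> v x x (- g i + g j)
        (inv_into UNIV (\<alpha> (g i)) (star (a i) * a j * star (\<sigma> (g i) (- g i + g j)))))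
        * \<sigma> (g i) (- g i + g j))"
      unfolding entry by (rule Gram_matrix_positive) (intro rho v x)
  qed
qed

text \<open>
  For \<open>p, q, r, s = \<langle>x, S x\<rangle>, \<langle>x, S y\<rangle>, \<langle>y, S x\<rangle>, \<langle>y, S y\<rangle>\<close> this is
  \<open>\<langle>x, S y\<rangle> = (1/4) \<Sum> (-i)\<^sup>k \<langle>x + i\<^sup>k y, S (x + i\<^sup>k y)\<rangle>\<close>, the sum being over \<open>k < 4\<close>.
\<close>

lemma scaleC_polarization:
  fixes p q r s :: "'a::unital_cstar_algebra"
  shows "q = (1/4) *\<^sub>C (p + q + r + s) - (\<i>/4) *\<^sub>C (p + \<i> *\<^sub>C q - \<i> *\<^sub>C r + s)
    - (1/4) *\<^sub>C (p - q - r + s) + (\<i>/4) *\<^sub>C (p - \<i> *\<^sub>C q + \<i> *\<^sub>C r + s)"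
proof -
  have "q = (1/4 + 1/4 + 1/4 + 1/4) *\<^sub>C q" by simp
  also have "\<dots> = (1/4) *\<^sub>C q + (1/4) *\<^sub>C q + (1/4) *\<^sub>C q + (1/4) *\<^sub>C q"
    by (simp only: scaleC_add_left)
  finally have "q = \<dots>" .
  then show ?thesis
    by (simp add: scaleC_add_right scaleC_diff_right scaleC_scaleC scaleC_minus_left)
qed

lemma coefficient_maps_subset_span:
  fixes \<alpha> :: "'g::group_add \<Rightarrow> 'a::unital_cstar_algebra \<Rightarrow> 'a"
  assumes tds: "twisted_dynamical_system \<alpha> \<sigma>"
  shows "coefficient_maps TYPE('x) \<alpha> \<sigma> \<subseteq> complex_span (positive_definite_maps \<alpha> \<sigma>)"
proof
  interpret V: vector_space "map_scaleC :: complex \<Rightarrow> ('g \<Rightarrow> 'a \<Rightarrow> 'a) \<Rightarrow> _"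
    by (rule vector_space_map_scaleC)
  fix T assume "T \<in> coefficient_maps TYPE('x) \<alpha> \<sigma>"
  then obtain X :: "('a, 'x) module_data" and \<rho> v x y where
    X: "hilbert_module X" and eq: "equivariant_representation \<alpha> \<sigma> X \<rho> v"
    and x: "x \<in> carrier X" and y: "y \<in> carrier X" and T: "T = coefficient X \<rho> v x y"
    unfolding coefficient_maps_def by blast
  interpret hilbert_module X by fact
  have rep: "star_representation X \<rho>" and bi: "\<And>g. bounded_invertible X (v g)"
    using eq by (auto simp: equivariant_representation_def)
  have adj: "is_adjoint X (\<rho> a) (\<rho> (star a))" for a
    using rep by (auto simp: star_representation_def)
  have rho: "\<rho> a z \<in> carrier X" if "z \<in> carrier X" for a z
    using adj[of a] that by (auto simp: is_adjoint_def)
  have v: "v g z \<in> carrier X" if "z \<in> carrier X" for g z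
    using bi[of g] that by (auto simp: bounded_invertible_def bij_betw_def)
  have v_lin: "v g (x \<oplus>\<^bsub>X\<^esub> cscale X c y) = v g x \<oplus>\<^bsub>X\<^esub> cscale X c (v g y)" for g c
    using bi[of g] x y by (auto simp: bounded_invertible_def cscale_closed)
  have flip: "ip u (\<rho> a z) = ip (\<rho> (star a) u) z" if "u \<in> carrier X" "z \<in> carrier X" for a u z
    using adj[of "star a"] that by (auto simp: is_adjoint_def)
  define u where "u c = x \<oplus>\<^bsub>X\<^esub> cscale X c y" for c
  have u: "u c \<in> carrier X" for c unfolding u_def by (intro a_closed x y cscale_closed)
  define D where "D c = coefficient X \<rho> v (u c) (u c)" for c
  have expand: "D c g a = ip x (\<rho> a (v g x)) + c *\<^sub>C ip x (\<rho> a (v g y))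
      + cnj c *\<^sub>C ip y (\<rho> a (v g x)) + (cnj c * c) *\<^sub>C ip y (\<rho> a (v g y))" for c g a
  proof -
    have right: "ip w (\<rho> a (v g (u c))) = ip w (\<rho> a (v g x)) + c *\<^sub>C ip w (\<rho> a (v g y))"
      if "w \<in> carrier X" for w
      using that by (simp add: flip x y u v rho cscale_closed)
        (simp add: u_def v_lin inner_add inner_cscale x y v rho cscale_closed)
    have "D c g a = ip x (\<rho> a (v g (u c))) + cnj c *\<^sub>C ip y (\<rho> a (v g (u c)))"
      unfolding D_def coefficient_def
      by (subst (1) u_def) (simp add: inner_add_left inner_cscale_left x y u v rho cscale_closed)
    then show ?thesis
      by (simp add: right x y scaleC_add_right scaleC_scaleC add.assoc)
  qed
  have "T = map_scaleC (1/4) (D 1) + map_scaleC (-\<i>/4) (D \<i>) + map_scaleC (-1/4) (D (-1))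
      + map_scaleC (\<i>/4) (D (-\<i>))"
  proof (intro ext)
    fix g a
    let ?z = "\<lambda>x y. ip x (\<rho> a (v g y))"
    show "T g a = (map_scaleC (1/4) (D 1) + map_scaleC (-\<i>/4) (D \<i>) + map_scaleC (-1/4) (D (-1))
      + map_scaleC (\<i>/4) (D (-\<i>))) g a"
      using scaleC_polarization[of "?z x y" "?z x x" "?z y x" "?z y y"]
      by (simp add: T coefficient_def map_scaleC_def expand scaleC_minus_left)
  qed
  also have "\<dots> \<in> complex_span (positive_definite_maps \<alpha> \<sigma>)"
    unfolding complex_span_def D_def
    by (intro V.span_add V.span_scale V.span_base coefficient_positive_definite[OF tds X eq] u)
  finally show "T \<in> complex_span (positive_definite_maps \<alpha> \<sigma>)" .
qed

section \<open>The Hilbert module of a positive kernel\<close>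

text \<open>
  A list of pairs \<open>(s, a)\<close> represents the formal combination \<open>\<Sum> \<delta>\<^sub>s a\<close> in the free right \<open>A\<close>-module on the
  index set. \<open>comb_eval L f\<close> is the inner product of this combination with \<open>f\<close>, where \<open>f(s)\<close> is read as
  \<open>\<langle>\<delta>\<^sub>s, f\<rangle>\<close>.
\<close>

definition comb_eval :: "('i \<times> 'a) list \<Rightarrow> ('i \<Rightarrow> 'a) \<Rightarrow> 'a::unital_cstar_algebra" where
  "comb_eval L f = (\<Sum>(s, a)\<leftarrow>L. star a * f s)"

definition comb_act :: "('i \<times> 'a) list \<Rightarrow> 'a \<Rightarrow> ('i \<times> 'a::unital_cstar_algebra) list" where
  "comb_act L b = map (\<lambda>(s, a). (s, a * b)) L"

lemma comb_eval_Nil [simp]: "comb_eval [] f = 0"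
  and comb_eval_Cons [simp]: "comb_eval ((s, a) # L) f = star a * f s + comb_eval L f"
  and comb_eval_append [simp]: "comb_eval (L @ M) f = comb_eval L f + comb_eval M f"
  by (simp_all add: comb_eval_def)

lemma comb_eval_act [simp]: "comb_eval (comb_act L b) f = star b * comb_eval L f"
  by (induction L) (auto simp: comb_act_def star_mult algebra_simps)

lemma comb_eval_add: "comb_eval L (f + g) = comb_eval L f + comb_eval L g"
  by (induction L) (auto simp: algebra_simps)

lemma comb_eval_diff: "comb_eval L (f - g) = comb_eval L f - comb_eval L g"
  by (induction L) (auto simp: algebra_simps)

lemma comb_eval_add_fun: "comb_eval L (\<lambda>s. f s + g s) = comb_eval L f + comb_eval L g"
  by (induction L) (auto simp: algebra_simps)

lemma comb_eval_zero [simp]: "comb_eval L 0 = 0"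
  by (induction L) auto

lemma comb_eval_uminus: "comb_eval L (\<lambda>s. - f s) = - comb_eval L f"
  by (induction L) auto

lemma comb_eval_mult: "comb_eval L (\<lambda>s. f s * b) = comb_eval L f * b"
  by (induction L) (auto simp: algebra_simps)

lemma comb_eval_scaleC: "comb_eval L (\<lambda>s. c *\<^sub>C f s) = c *\<^sub>C comb_eval L f"
  by (induction L) (auto simp: mult_scaleC_right scaleC_add_right)

lemma tendsto_comb_eval:
  "(\<And>s. (\<lambda>n. f n s) \<longlonglongrightarrow> g s) \<Longrightarrow> (\<lambda>n. comb_eval L (f n)) \<longlonglongrightarrow> comb_eval L g"
  by (induction L) (auto intro!: tendsto_intros)

text \<open>
  The reproducing kernel Hilbert module of \<open>K\<close>. A vector is represented by the function of its inner
  products with the generators, so that \<open>\<delta>\<^sub>s\<close> becomes \<open>K(_, s)\<close> and all module operations are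
  pointwise.
\<close>

locale positive_kernel =
  fixes K :: "'i \<Rightarrow> 'i \<Rightarrow> 'a::unital_cstar_algebra"
  assumes kernel_star: "star (K s t) = K t s"
    and kernel_positive: "cstar_positive (comb_eval L (\<lambda>t. \<Sum>(s, a)\<leftarrow>L. K t s * a))"
begin

definition comb :: "('i \<times> 'a) list \<Rightarrow> 'i \<Rightarrow> 'a" where
  "comb L = (\<lambda>t. \<Sum>(s, a)\<leftarrow>L. K t s * a)"

definition comb_norm :: "('i \<times> 'a) list \<Rightarrow> real" where
  "comb_norm L = sqrt (norm (comb_eval L (comb L)))"

text \<open>
  The norm of \<open>f\<close> as a functional on the combinations is at most \<open>c\<close>. On the module it agrees with the
  Hilbert module norm (\<open>bounded_by_kernel_inner\<close>, \<open>kernel_inner_norm_le\<close>), but it makes sense before the inner product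
  is defined.
\<close>

definition bounded_by :: "('i \<Rightarrow> 'a) \<Rightarrow> real \<Rightarrow> bool" where
  "bounded_by f c \<longleftrightarrow> (\<forall>L. norm (comb_eval L f) \<le> c * comb_norm L)"

definition approx :: "('i \<Rightarrow> 'a) \<Rightarrow> (nat \<Rightarrow> ('i \<times> 'a) list) \<Rightarrow> bool" where
  "approx f L \<longleftrightarrow> (\<exists>e. e \<longlonglongrightarrow> 0 \<and> (\<forall>n. bounded_by (f - comb (L n)) (e n)))"

text \<open>
  The closure of the combinations in the space of bounded functionals. Without the approximation by
  combinations, the inner product of two functionals need not have a value in \<open>A\<close>.
\<close>

definition kernel_space :: "('i \<Rightarrow> 'a) set" where
  "kernel_space = {f. \<exists>L. approx f L}"

definition kernel_inner :: "('i \<Rightarrow> 'a) \<Rightarrow> ('i \<Rightarrow> 'a) \<Rightarrow> 'a" where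
  "kernel_inner f g = lim (\<lambda>n. comb_eval ((SOME L. approx f L) n) g)"

definition kernel_module :: "('a, 'i \<Rightarrow> 'a) module_data" where
  "kernel_module = \<lparr>carrier = kernel_space, monoid.mult = (\<lambda>f g. f), one = 0, zero = 0, add = (+),
     cscale = (\<lambda>c f s. c *\<^sub>C f s), act = (\<lambda>f a s. f s * a), inner_prod = kernel_inner\<rparr>"

lemma comb_Nil: "comb [] = 0"
  and comb_Cons: "comb ((s, a) # L) = (\<lambda>t. K t s * a) + comb L"
  and comb_append: "comb (L @ M) = comb L + comb M"
  by (simp_all add: comb_def fun_eq_iff)

lemma comb_act: "comb (comb_act L b) = (\<lambda>t. comb L t * b)"
  by (induction L) (auto simp: comb_act_def comb_Nil comb_Cons fun_eq_iff algebra_simps)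

lemma comb_eval_comb_star: "star (comb_eval L (comb M)) = comb_eval M (comb L)"
proof (induction L)
  case Nil
  show ?case by (induction M) (auto simp: comb_Nil)
next
  case (Cons p L)
  obtain s a where p: "p = (s, a)" by (cases p)
  have "star (comb M s) = comb_eval M (\<lambda>t. K t s)"
    by (induction M) (auto simp: comb_Nil comb_Cons star_add star_mult kernel_star)
  then have "star (star a * comb M s) = comb_eval M (\<lambda>t. K t s * a)"
    by (simp add: star_mult comb_eval_mult)
  with Cons show ?case by (simp add: p comb_Cons comb_eval_add comb_eval_add_fun star_add)
qed

lemma comb_eval_comb_positive: "cstar_positive (comb_eval L (comb L))"
  unfolding comb_def by (rule kernel_positive)

lemma comb_norm_nonneg [simp]: "comb_norm L \<ge> 0"
  by (simp add: comb_norm_def)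

lemma comb_norm_square: "comb_norm L ^ 2 = norm (comb_eval L (comb L))"
  by (simp add: comb_norm_def)

text \<open>
  The Cauchy-Schwarz inequality for the semi-inner product of combinations.
\<close>

lemma bounded_by_comb: "bounded_by (comb M) (comb_norm M)"
  unfolding bounded_by_def
proof
  fix L
  have "norm (comb_eval L (comb M)) ^ 2 \<le> norm (comb_eval L (comb L)) * norm (comb_eval M (comb M))"
  proof (rule cstar_Cauchy_Schwarz[OF _ comb_eval_comb_positive])
    fix a
    show "cstar_positive (star a * comb_eval L (comb L) * a - star a * comb_eval L (comb M)
        - star (comb_eval L (comb M)) * a + comb_eval M (comb M))"
      using comb_eval_comb_positive[of "comb_act L a @ comb_act M (- 1)"]
      by (simp add: comb_append comb_act comb_eval_add comb_eval_mult comb_eval_comb_star comb_eval_uminus algebra_simps)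
  qed
  then have "norm (comb_eval L (comb M)) ^ 2 \<le> (comb_norm M * comb_norm L) ^ 2"
    by (simp add: power_mult_distrib comb_norm_square mult.commute)
  then show "norm (comb_eval L (comb M)) \<le> comb_norm M * comb_norm L"
    by (rule power2_le_imp_le) simp
qed

lemma bounded_by_mono: "bounded_by f c \<Longrightarrow> c \<le> d \<Longrightarrow> bounded_by f d"
  unfolding bounded_by_def by (meson comb_norm_nonneg mult_right_mono order_trans)

lemma bounded_by_add: "bounded_by f c \<Longrightarrow> bounded_by g d \<Longrightarrow> bounded_by (f + g) (c + d)"
  unfolding bounded_by_def comb_eval_add distrib_right by (meson norm_triangle_mono)

lemma bounded_by_minus: "bounded_by (f - g) c \<Longrightarrow> bounded_by (g - f) c"
  unfolding bounded_by_def comb_eval_diff by (simp add: norm_minus_commute)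

lemma bounded_by_mult: "bounded_by f c \<Longrightarrow> bounded_by (\<lambda>s. f s * a) (c * norm a)"
  unfolding bounded_by_def comb_eval_mult
proof
  fix L assume "\<forall>L. norm (comb_eval L f) \<le> c * comb_norm L"
  then have "norm (comb_eval L f) * norm a \<le> c * comb_norm L * norm a"
    by (intro mult_right_mono) auto
  then show "norm (comb_eval L f * a) \<le> c * norm a * comb_norm L"
    using norm_mult_ineq[of "comb_eval L f" a] by (simp add: mult_ac)
qed

lemma bounded_by_point: "bounded_by f c \<Longrightarrow> norm (f s) \<le> c * comb_norm [(s, 1)]"
  unfolding bounded_by_def by (drule spec[of _ "[(s, 1)]"]) simp

lemma comb_norm_le:
  assumes "bounded_by (comb L) c"
  shows "comb_norm L \<le> \<bar>c\<bar>"
proof -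
  have "comb_norm L ^ 2 \<le> c * comb_norm L"
    using assms by (auto simp: bounded_by_def comb_norm_square)
  then have "comb_norm L * comb_norm L \<le> \<bar>c\<bar> * comb_norm L"
    by (simp add: power2_eq_square order_trans[OF _ mult_right_mono])
  then show ?thesis
    using comb_norm_nonneg[of L] by (cases "comb_norm L = 0") (auto simp: mult_le_cancel_right)
qed

lemma kernel_spaceI: "approx f L \<Longrightarrow> f \<in> kernel_space"
  by (auto simp: kernel_space_def)

lemma approx_comb: "approx (comb L) (\<lambda>_. L)"
  unfolding approx_def bounded_by_def by (auto intro!: exI[of _ "\<lambda>_. 0"] simp: comb_eval_diff)

lemma comb_in_kernel_space: "comb L \<in> kernel_space"
  by (rule kernel_spaceI[OF approx_comb])

lemma approx_add: "approx f L \<Longrightarrow> approx g M \<Longrightarrow> approx (f + g) (\<lambda>n. L n @ M n)"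
proof -
  assume "approx f L" "approx g M"
  then obtain d e where "d \<longlonglongrightarrow> 0" "\<And>n. bounded_by (f - comb (L n)) (d n)"
      "e \<longlonglongrightarrow> 0" "\<And>n. bounded_by (g - comb (M n)) (e n)"
    unfolding approx_def by blast
  then show ?thesis
    unfolding approx_def using tendsto_add[of d 0 sequentially e 0] bounded_by_add
    by (intro exI[of _ "\<lambda>n. d n + e n"]) (fastforce simp: comb_append algebra_simps)
qed

lemma approx_act: "approx f L \<Longrightarrow> approx (\<lambda>s. f s * a) (\<lambda>n. comb_act (L n) a)"
proof -
  assume "approx f L"
  then obtain e where e: "e \<longlonglongrightarrow> 0" "\<And>n. bounded_by (f - comb (L n)) (e n)"
    unfolding approx_def by blast
  have "bounded_by ((\<lambda>s. f s * a) - comb (comb_act (L n) a)) (e n * norm a)" for n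
    using bounded_by_mult[OF e(2)[of n], of a] by (simp add: comb_act fun_diff_def left_diff_distrib)
  then show ?thesis
    unfolding approx_def using tendsto_mult_right[OF e(1), of "norm a"] by (intro exI[of _ "\<lambda>n. e n * norm a"]) simp
qed

lemma kernel_space_add: "f \<in> kernel_space \<Longrightarrow> g \<in> kernel_space \<Longrightarrow> f + g \<in> kernel_space"
  unfolding kernel_space_def using approx_add by blast

lemma kernel_space_act: "f \<in> kernel_space \<Longrightarrow> (\<lambda>s. f s * a) \<in> kernel_space"
  unfolding kernel_space_def using approx_act by blast

lemma kernel_space_scaleC: "f \<in> kernel_space \<Longrightarrow> (\<lambda>s. c *\<^sub>C f s) \<in> kernel_space"
  using kernel_space_act[of f "c *\<^sub>C 1"] by (simp add: mult_scaleC_right)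

lemma kernel_space_uminus: "f \<in> kernel_space \<Longrightarrow> - f \<in> kernel_space"
  using kernel_space_act[of f "- 1"] by (simp add: fun_Compl_def)

lemma kernel_space_diff: "f \<in> kernel_space \<Longrightarrow> g \<in> kernel_space \<Longrightarrow> f - g \<in> kernel_space"
  using kernel_space_add[OF _ kernel_space_uminus, of f g] by simp

lemma kernel_space_zero: "0 \<in> kernel_space"
  using comb_in_kernel_space[of "[]"] by (simp add: comb_Nil)

lemma kernel_space_bounded:
  assumes "f \<in> kernel_space" obtains c where "bounded_by f c"
proof -
  from assms obtain L :: "nat \<Rightarrow> _" and e where "\<And>n. bounded_by (f - comb (L n)) (e n)"
    unfolding kernel_space_def approx_def by blast
  then have "bounded_by (f - comb (L 0)) (e 0)" .
  from bounded_by_add[OF this bounded_by_comb[of "L 0"]] show ?thesis by (intro that) simp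
qed

text \<open>
  Two combinations near the same \<open>f\<close> are near each other, so their inner products with \<open>g\<close> are. This
  gives the convergence that defines \<open>kernel_inner\<close> and its independence of the approximation.
\<close>

lemma comb_eval_diff_le:
  assumes L: "bounded_by (f - comb L) d" and M: "bounded_by (f - comb M) e" and g: "bounded_by g c"
  shows "norm (comb_eval L g - comb_eval M g) \<le> \<bar>c\<bar> * \<bar>d + e\<bar>"
proof -
  let ?N = "L @ comb_act M (- 1)"
  have "bounded_by (comb L - comb M) (d + e)"
    using bounded_by_add[OF bounded_by_minus[OF L] M] by (simp add: add.commute)
  also have "comb L - comb M = comb ?N" by (simp add: comb_append comb_act fun_eq_iff)
  finally have "comb_norm ?N \<le> \<bar>d + e\<bar>" by (rule comb_norm_le)
  have "norm (comb_eval ?N g) \<le> c * comb_norm ?N" using g unfolding bounded_by_def by blast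
  also have "\<dots> \<le> \<bar>c\<bar> * \<bar>d + e\<bar>"
    using \<open>comb_norm ?N \<le> _\<close> by (intro mult_mono) auto
  finally show ?thesis by simp
qed

lemma kernel_inner_tendsto:
  assumes f: "approx f L" and g: "g \<in> kernel_space"
  shows "(\<lambda>n. comb_eval (L n) g) \<longlonglongrightarrow> kernel_inner f g"
proof -
  obtain c where c: "bounded_by g c" using kernel_space_bounded[OF g] .
  define M where "M = (SOME M. approx f M)"
  have M: "approx f M" using someI[of "approx f", OF f] by (simp add: M_def)
  obtain d where d: "d \<longlonglongrightarrow> 0" "\<And>n. bounded_by (f - comb (L n)) (d n)"
    using f unfolding approx_def by blast
  obtain e where e: "e \<longlonglongrightarrow> 0" "\<And>n. bounded_by (f - comb (M n)) (e n)"
    using M unfolding approx_def by blast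
  have "Cauchy (\<lambda>n. comb_eval (M n) g)"
  proof (rule metric_CauchyI)
    fix r :: real assume r: "r > 0"
    have "(\<lambda>n. \<bar>c\<bar> * \<bar>e n\<bar>) \<longlonglongrightarrow> \<bar>c\<bar> * \<bar>0\<bar>" by (intro tendsto_intros e)
    then have "eventually (\<lambda>n. \<bar>c\<bar> * \<bar>e n\<bar> < r / 2) sequentially"
      using r by (intro order_tendstoD(2)[of _ "0::real"]) auto
    then obtain N where N: "\<And>n. n \<ge> N \<Longrightarrow> \<bar>c\<bar> * \<bar>e n\<bar> < r / 2"
      by (auto simp: eventually_sequentially)
    have "dist (comb_eval (M m) g) (comb_eval (M n) g) < r" if "m \<ge> N" "n \<ge> N" for m n
    proof -
      have "dist (comb_eval (M m) g) (comb_eval (M n) g) \<le> \<bar>c\<bar> * \<bar>e m + e n\<bar>"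
        unfolding dist_norm by (rule comb_eval_diff_le[OF e(2) e(2) c])
      also have "\<dots> \<le> \<bar>c\<bar> * (\<bar>e m\<bar> + \<bar>e n\<bar>)" by (intro mult_left_mono) auto
      also have "\<dots> < r" using N[OF that(1)] N[OF that(2)] by (simp add: distrib_left)
      finally show ?thesis .
    qed
    then show "\<exists>N. \<forall>m\<ge>N. \<forall>n\<ge>N. dist (comb_eval (M m) g) (comb_eval (M n) g) < r" by blast
  qed
  then have lim: "(\<lambda>n. comb_eval (M n) g) \<longlonglongrightarrow> kernel_inner f g"
    unfolding kernel_inner_def M_def[symmetric] by (simp add: Cauchy_convergent convergent_LIMSEQ_iff[symmetric])
  have "(\<lambda>n. comb_eval (L n) g - comb_eval (M n) g) \<longlonglongrightarrow> 0"
  proof (rule Lim_null_comparison)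
    show "eventually (\<lambda>n. norm (comb_eval (L n) g - comb_eval (M n) g) \<le> \<bar>c\<bar> * \<bar>d n + e n\<bar>) sequentially"
      using comb_eval_diff_le[OF d(2) e(2) c] by simp
    have "(\<lambda>n. \<bar>c\<bar> * \<bar>d n + e n\<bar>) \<longlonglongrightarrow> \<bar>c\<bar> * \<bar>0 + 0\<bar>" by (intro tendsto_intros d e)
    then show "(\<lambda>n. \<bar>c\<bar> * \<bar>d n + e n\<bar>) \<longlonglongrightarrow> 0" by simp
  qed
  from tendsto_add[OF this lim] show ?thesis by simp
qed

lemma kernel_inner_comb: "g \<in> kernel_space \<Longrightarrow> kernel_inner (comb L) g = comb_eval L g"
  using kernel_inner_tendsto[OF approx_comb] by (metis LIMSEQ_const_iff)

lemma kernel_inner_eqI: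
  "approx f L \<Longrightarrow> g \<in> kernel_space \<Longrightarrow> (\<lambda>n. comb_eval (L n) g) \<longlonglongrightarrow> z \<Longrightarrow> kernel_inner f g = z"
  using kernel_inner_tendsto LIMSEQ_unique by blast

lemma kernel_inner_add_right: "f \<in> kernel_space \<Longrightarrow> g \<in> kernel_space \<Longrightarrow> h \<in> kernel_space \<Longrightarrow> kernel_inner f (g + h) = kernel_inner f g + kernel_inner f h"
  unfolding kernel_space_def mem_Collect_eq[of f]
  by (elim exE, rule kernel_inner_eqI) (auto simp: comb_eval_add kernel_spaceI intro!: tendsto_intros kernel_inner_tendsto kernel_space_add)

lemma kernel_inner_act_right: "f \<in> kernel_space \<Longrightarrow> g \<in> kernel_space \<Longrightarrow> kernel_inner f (\<lambda>s. g s * a) = kernel_inner f g * a"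
  unfolding kernel_space_def mem_Collect_eq[of f]
  by (elim exE, rule kernel_inner_eqI) (auto simp: comb_eval_mult kernel_spaceI intro!: tendsto_intros kernel_inner_tendsto kernel_space_act)

lemma kernel_inner_scaleC_right: "f \<in> kernel_space \<Longrightarrow> g \<in> kernel_space \<Longrightarrow> kernel_inner f (\<lambda>s. c *\<^sub>C g s) = c *\<^sub>C kernel_inner f g"
  unfolding kernel_space_def mem_Collect_eq[of f]
  by (elim exE, rule kernel_inner_eqI)
    (auto simp: comb_eval_scaleC kernel_spaceI intro!: tendsto_scaleC kernel_inner_tendsto kernel_space_scaleC)

lemma comb_norm_approx_bounded:
  assumes "approx f L" obtains C where "\<And>n. comb_norm (L n) \<le> C"
proof -
  obtain e where e: "e \<longlonglongrightarrow> 0" "\<And>n. bounded_by (f - comb (L n)) (e n)"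
    using assms unfolding approx_def by blast
  obtain c where c: "bounded_by f c" using kernel_space_bounded[OF kernel_spaceI[OF assms]] .
  obtain B where B: "\<And>n. \<bar>e n\<bar> \<le> B"
    using convergent_imp_Bseq[OF convergentI[OF e(1)]] by (auto simp: Bseq_def)
  have "comb_norm (L n) \<le> B + \<bar>c\<bar>" for n
  proof -
    have "bounded_by (comb (L n)) (e n + c)"
      using bounded_by_add[OF bounded_by_minus[OF e(2)] c] by simp
    from comb_norm_le[OF this] show ?thesis using B[of n] by linarith
  qed
  with that show ?thesis by blast
qed

lemma kernel_inner_tendsto_comb:
  assumes f: "approx f L" and g: "approx g M"
  shows "(\<lambda>n. comb_eval (L n) (comb (M n))) \<longlonglongrightarrow> kernel_inner f g"
proof -
  obtain e where e: "e \<longlonglongrightarrow> 0" "\<And>n. bounded_by (g - comb (M n)) (e n)"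
    using g unfolding approx_def by blast
  obtain C where C: "\<And>n. comb_norm (L n) \<le> C" using comb_norm_approx_bounded[OF f] by blast
  have "(\<lambda>n. comb_eval (L n) (g - comb (M n))) \<longlonglongrightarrow> 0"
  proof (rule Lim_null_comparison)
    have "norm (comb_eval (L n) (g - comb (M n))) \<le> \<bar>e n\<bar> * C" for n
    proof -
      have "norm (comb_eval (L n) (g - comb (M n))) \<le> e n * comb_norm (L n)"
        using e(2) by (auto simp: bounded_by_def)
      also have "\<dots> \<le> \<bar>e n\<bar> * C" using C by (intro mult_mono) auto
      finally show ?thesis .
    qed
    then show "eventually (\<lambda>n. norm (comb_eval (L n) (g - comb (M n))) \<le> \<bar>e n\<bar> * C) sequentially"
      by simp
    have "(\<lambda>n. \<bar>e n\<bar> * C) \<longlonglongrightarrow> \<bar>0\<bar> * C" by (intro tendsto_intros e)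
    then show "(\<lambda>n. \<bar>e n\<bar> * C) \<longlonglongrightarrow> 0" by simp
  qed
  from tendsto_diff[OF kernel_inner_tendsto[OF f kernel_spaceI[OF g]] this] show ?thesis
    by (simp add: comb_eval_diff)
qed

lemma kernel_inner_commute: "f \<in> kernel_space \<Longrightarrow> g \<in> kernel_space \<Longrightarrow> kernel_inner g f = star (kernel_inner f g)"
proof -
  assume "f \<in> kernel_space" "g \<in> kernel_space"
  then obtain L M where L: "approx f L" and M: "approx g M" by (auto simp: kernel_space_def)
  from tendsto_star[OF kernel_inner_tendsto_comb[OF L M]]
  have "(\<lambda>n. comb_eval (M n) (comb (L n))) \<longlonglongrightarrow> star (kernel_inner f g)"
    by (simp add: comb_eval_comb_star)
  then show ?thesis using kernel_inner_tendsto_comb[OF M L] LIMSEQ_unique by blast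
qed

lemma kernel_inner_self_positive: "f \<in> kernel_space \<Longrightarrow> cstar_positive (kernel_inner f f)"
  unfolding kernel_space_def mem_Collect_eq
  by (elim exE, rule cstar_positive_limit[OF kernel_inner_tendsto_comb]) (auto simp: comb_eval_comb_positive)

text \<open>
  Pass to the limit in the Cauchy-Schwarz inequality for combinations.
\<close>

lemma bounded_by_kernel_inner:
  assumes "f \<in> kernel_space"
  shows "bounded_by f (sqrt (norm (kernel_inner f f)))"
  unfolding bounded_by_def
proof
  fix M
  obtain L where L: "approx f L" using assms by (auto simp: kernel_space_def)
  have 1: "(\<lambda>n. comb_eval M (comb (L n))) \<longlonglongrightarrow> comb_eval M f"
    using kernel_inner_tendsto_comb[OF approx_comb L] assms by (simp add: kernel_inner_comb)
  have 2: "(\<lambda>n. comb_norm (L n)) \<longlonglongrightarrow> sqrt (norm (kernel_inner f f))"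
    unfolding comb_norm_def by (intro tendsto_intros kernel_inner_tendsto_comb L)
  show "norm (comb_eval M f) \<le> sqrt (norm (kernel_inner f f)) * comb_norm M"
  proof (rule LIMSEQ_le[OF tendsto_norm[OF 1] tendsto_mult_right[OF 2]])
    show "\<exists>N. \<forall>n\<ge>N. norm (comb_eval M (comb (L n))) \<le> comb_norm (L n) * comb_norm M"
      using bounded_by_comb unfolding bounded_by_def by blast
  qed
qed

lemma kernel_inner_norm_le:
  assumes "f \<in> kernel_space" "bounded_by f c" "c \<ge> 0"
  shows "sqrt (norm (kernel_inner f f)) \<le> c"
proof -
  let ?h = "sqrt (norm (kernel_inner f f))"
  obtain L where L: "approx f L" using assms by (auto simp: kernel_space_def)
  have 1: "(\<lambda>n. comb_eval (L n) f) \<longlonglongrightarrow> kernel_inner f f" by (rule kernel_inner_tendsto[OF L assms(1)])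
  have 2: "(\<lambda>n. comb_norm (L n)) \<longlonglongrightarrow> ?h"
    unfolding comb_norm_def by (intro tendsto_intros kernel_inner_tendsto_comb L)
  have "norm (kernel_inner f f) \<le> c * ?h"
  proof (rule LIMSEQ_le[OF tendsto_norm[OF 1] tendsto_mult_left[OF 2]])
    show "\<exists>N. \<forall>n\<ge>N. norm (comb_eval (L n) f) \<le> c * comb_norm (L n)"
      using assms(2) unfolding bounded_by_def by blast
  qed
  then have "?h * ?h \<le> c * ?h" by simp
  then show ?thesis using assms(3) by (cases "?h = 0") (auto simp: mult_le_cancel_right simp del: real_sqrt_eq_zero_cancel_iff real_sqrt_mult_self)
qed

lemma bounded_by_zero: "bounded_by f 0 \<Longrightarrow> f = 0"
  using bounded_by_point[of f 0] by (simp add: fun_eq_iff)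

lemma kernel_space_approximable:
  assumes "\<And>e. e > 0 \<Longrightarrow> \<exists>g\<in>kernel_space. bounded_by (f - g) e"
  shows "f \<in> kernel_space"
proof -
  have "\<exists>L. bounded_by (f - comb L) e" if e: "e > 0" for e
  proof -
    obtain g where g: "g \<in> kernel_space" "bounded_by (f - g) (e / 2)" using assms[of "e / 2"] e by auto
    obtain L d where d: "d \<longlonglongrightarrow> 0" "\<And>n. bounded_by (g - comb (L n)) (d n)"
      using g(1) unfolding kernel_space_def approx_def by blast
    have "eventually (\<lambda>n. d n < e / 2) sequentially"
      using d(1) e by (intro order_tendstoD(2)[of _ "0::real"]) auto
    then obtain n where "d n < e / 2" by (auto simp: eventually_sequentially)
    then have "bounded_by (f - comb (L n)) e"
      by (intro bounded_by_mono[OF bounded_by_add[OF g(2) d(2)[of n], simplified]]) simp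
    then show ?thesis by blast
  qed
  then have "\<exists>L. bounded_by (f - comb L) (inverse (real (Suc n)))" for n by simp
  then obtain L where "\<And>n. bounded_by (f - comb (L n)) (inverse (real (Suc n)))" by metis
  then have "approx f L"
    unfolding approx_def using LIMSEQ_inverse_real_of_nat by blast
  then show ?thesis by (rule kernel_spaceI)
qed

lemma kernel_module_simps [simp]:
  "carrier kernel_module = kernel_space" "zero kernel_module = 0" "add kernel_module = (+)"
  "cscale kernel_module = (\<lambda>c f s. c *\<^sub>C f s)" "act kernel_module = (\<lambda>f a s. f s * a)"
  "inner_prod kernel_module = kernel_inner"
  by (simp_all add: kernel_module_def)

lemma abelian_group_kernel_module: "abelian_group kernel_module"
proof (rule abelian_groupI)
  fix f assume "f \<in> carrier kernel_module"
  then show "\<exists>g\<in>carrier kernel_module. g \<oplus>\<^bsub>kernel_module\<^esub> f = \<zero>\<^bsub>kernel_module\<^esub>"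
    by (intro bexI[of _ "- f"]) (auto intro: kernel_space_uminus)
qed (auto simp: kernel_space_add kernel_space_zero add.assoc add.commute)

lemma kernel_module_minus:
  assumes "f \<in> kernel_space" "g \<in> kernel_space"
  shows "f \<ominus>\<^bsub>kernel_module\<^esub> g = f - g"
proof -
  interpret abelian_group kernel_module by (rule abelian_group_kernel_module)
  have "\<ominus>\<^bsub>kernel_module\<^esub> g = - g"
    using assms by (intro minus_equality) (auto intro: kernel_space_uminus)
  then show ?thesis by (simp add: a_minus_def)
qed

text \<open>
  A Cauchy sequence converges pointwise, because evaluation at \<open>s\<close> is the inner product with
  \<open>\<delta>\<^sub>s\<close>. The pointwise limit is also the limit in the norm of functionals, so it lies in the closure.
\<close>

lemma hilbert_module_kernel_module: "hilbert_module kernel_module"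
proof (intro hilbert_module.intro abelian_group_kernel_module hilbert_module_axioms.intro,
    simp_all only: kernel_module_simps)
  fix s :: "nat \<Rightarrow> 'i \<Rightarrow> 'a"
  assume s: "range s \<subseteq> kernel_space"
    and hc: "\<forall>e>0. \<exists>N. \<forall>m\<ge>N. \<forall>n\<ge>N. hnorm kernel_module (s m \<ominus>\<^bsub>kernel_module\<^esub> s n) < e"
  have cauchy: "\<exists>N. \<forall>m\<ge>N. \<forall>n\<ge>N. bounded_by (s m - s n) e" if e: "e > 0" for e
  proof -
    obtain N where "\<And>m n. m \<ge> N \<Longrightarrow> n \<ge> N \<Longrightarrow> hnorm kernel_module (s m \<ominus>\<^bsub>kernel_module\<^esub> s n) < e"
      using e hc by meson
    then have "bounded_by (s m - s n) e" if "m \<ge> N" "n \<ge> N" for m n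
      using that s by (intro bounded_by_mono[OF bounded_by_kernel_inner[OF kernel_space_diff]])
        (auto simp: hnorm_def kernel_module_minus range_subsetD less_imp_le)
    then show ?thesis by blast
  qed
  have "Cauchy (\<lambda>n. s n t)" for t
  proof (rule metric_CauchyI)
    fix r :: real assume r: "r > 0"
    define d where "d = comb_norm [(t, 1)] + 1"
    have d: "d > 0" unfolding d_def by (simp add: add_nonneg_pos)
    define e where "e = r / (2 * d)"
    have e: "e > 0" unfolding e_def using r d by simp
    obtain N where N: "\<And>m n. m \<ge> N \<Longrightarrow> n \<ge> N \<Longrightarrow> bounded_by (s m - s n) e" using cauchy[OF e] by blast
    have "dist (s m t) (s n t) < r" if "m \<ge> N" "n \<ge> N" for m n
    proof -
      have "dist (s m t) (s n t) \<le> e * comb_norm [(t, 1)]"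
        using bounded_by_point[OF N[OF that], of t] by (simp add: dist_norm)
      also have "\<dots> \<le> e * d" using e by (simp add: d_def)
      also have "\<dots> = r / 2" using d by (simp add: e_def)
      finally show ?thesis using r by simp
    qed
    then show "\<exists>N. \<forall>m\<ge>N. \<forall>n\<ge>N. dist (s m t) (s n t) < r" by blast
  qed
  then have "\<exists>y. (\<lambda>n. s n t) \<longlonglongrightarrow> y" for t by (simp add: Cauchy_convergent_iff convergent_def)
  then obtain f where f: "\<And>t. (\<lambda>n. s n t) \<longlonglongrightarrow> f t" by metis
  have lim: "\<exists>N. \<forall>m\<ge>N. bounded_by (s m - f) e" if e: "e > 0" for e
  proof -
    obtain N where N: "\<And>m n. m \<ge> N \<Longrightarrow> n \<ge> N \<Longrightarrow> bounded_by (s m - s n) e" using cauchy[OF e] by blast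
    have "norm (comb_eval L (s m - f)) \<le> e * comb_norm L" if m: "m \<ge> N" for m L
    proof (rule LIMSEQ_le_const2)
      show "(\<lambda>n. norm (comb_eval L (s m - s n))) \<longlonglongrightarrow> norm (comb_eval L (s m - f))"
        by (intro tendsto_norm tendsto_comb_eval) (auto intro!: tendsto_intros f)
      show "\<exists>N. \<forall>n\<ge>N. norm (comb_eval L (s m - s n)) \<le> e * comb_norm L"
        using N[OF m] by (auto simp: bounded_by_def)
    qed
    then show ?thesis by (auto simp: bounded_by_def)
  qed
  have f_space: "f \<in> kernel_space"
  proof (rule kernel_space_approximable)
    fix e :: real assume "e > 0"
    from lim[OF this] obtain N where "bounded_by (s N - f) e" by blast
    then show "\<exists>g\<in>kernel_space. bounded_by (f - g) e" using s bounded_by_minus by blast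
  qed
  show "\<exists>x\<in>kernel_space. (\<lambda>n. hnorm kernel_module (s n \<ominus>\<^bsub>kernel_module\<^esub> x)) \<longlonglongrightarrow> 0"
  proof (intro bexI[of _ f] f_space LIMSEQ_I)
    fix r :: real assume r: "r > 0"
    then obtain N where N: "\<And>m. m \<ge> N \<Longrightarrow> bounded_by (s m - f) (r / 2)" using lim[of "r / 2"] by auto
    have "hnorm kernel_module (s m \<ominus>\<^bsub>kernel_module\<^esub> f) < r" if "m \<ge> N" for m
    proof -
      have sm: "s m \<in> kernel_space" using s by auto
      have "hnorm kernel_module (s m \<ominus>\<^bsub>kernel_module\<^esub> f) \<le> r / 2"
        unfolding hnorm_def kernel_module_minus[OF sm f_space] kernel_module_simps
        using r by (intro kernel_inner_norm_le kernel_space_diff sm f_space N that) simp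
      then show ?thesis using r by simp
    qed
    then show "\<exists>N. \<forall>n\<ge>N. norm (hnorm kernel_module (s n \<ominus>\<^bsub>kernel_module\<^esub> f) - 0) < r"
      by (auto simp: hnorm_def)
  qed
next
  fix f assume f: "f \<in> kernel_space" and "kernel_inner f f = 0"
  then show "f = 0" using bounded_by_kernel_inner[OF f] by (simp add: bounded_by_zero)
qed (auto simp: kernel_space_add kernel_space_act kernel_space_scaleC kernel_inner_add_right kernel_inner_act_right kernel_inner_scaleC_right
    kernel_inner_self_positive fun_eq_iff scaleC_add_right scaleC_add_left scaleC_scaleC
    mult_scaleC_left mult_scaleC_right distrib_left distrib_right mult.assoc intro: kernel_inner_commute)

text \<open>
  The hypothesis makes \<open>L\<close> a combination of norm zero, on which bounded functionals vanish. Linear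
  relations between the kernel functions thereby extend to relations between the values of every
  element of the module.
\<close>

lemma comb_eval_null:
  assumes "f \<in> kernel_space" "\<And>M. comb_eval L (comb M) = 0"
  shows "comb_eval L f = 0"
proof -
  obtain c where "bounded_by f c" using kernel_space_bounded[OF assms(1)] .
  then have "norm (comb_eval L f) \<le> c * comb_norm L" unfolding bounded_by_def by blast
  then show ?thesis by (simp add: comb_norm_def assms(2))
qed

text \<open>
  How an operator \<open>U\<close> on functions extends to the module: it suffices to know its effect \<open>W\<close> on
  combinations and a bound on functionals. The absolute value covers a possibly negative bound \<open>c\<close>.
\<close>

lemma approx_image:
  assumes U_diff: "\<And>f g. U (f - g) = U f - U g" and U_comb: "\<And>L. U (comb L) = comb (W L)"
    and U_bounded: "\<And>f c. bounded_by f c \<Longrightarrow> bounded_by (U f) (C * \<bar>c\<bar>)" and f: "approx f L"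
  shows "approx (U f) (\<lambda>n. W (L n))"
proof -
  obtain e where e: "e \<longlonglongrightarrow> 0" "\<And>n. bounded_by (f - comb (L n)) (e n)"
    using f unfolding approx_def by blast
  have "(\<lambda>n. C * \<bar>e n\<bar>) \<longlonglongrightarrow> C * \<bar>0\<bar>" by (intro tendsto_intros e(1))
  moreover have "bounded_by (U f - comb (W (L n))) (C * \<bar>e n\<bar>)" for n
    using U_bounded[OF e(2)[of n]] by (simp add: U_diff U_comb)
  ultimately show ?thesis unfolding approx_def by (intro exI[of _ "\<lambda>n. C * \<bar>e n\<bar>"]) simp
qed

end

section \<open>Automorphisms and the twisted action\<close>

lemma automorphism_inv:
  assumes f: "cstar_automorphism f"
  shows "cstar_automorphism (inv_into UNIV f)"
proof -
  have b: "bij f" using f by (simp add: cstar_automorphism_def)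
  have 1: "f (inv_into UNIV f x) = x" for x using b by (simp add: bij_def surj_f_inv_f)
  have 2: "inv_into UNIV f x = y \<longleftrightarrow> x = f y" for x y
    using b 1 by (metis bij_def inv_f_f)
  show ?thesis
    using f b unfolding cstar_automorphism_def by (auto simp: 1 2 bij_imp_bij_inv)
qed

text \<open>
  A *-homomorphism preserves positivity, hence the inequality \<open>a\<^sup>*a \<le> \<parallel>a\<^sup>*a\<parallel>\<close>, and is contractive; the same
  holds for the inverse.
\<close>

lemma automorphism_norm:
  assumes f: "cstar_automorphism f"
  shows "norm (f a) = norm (a :: 'a::unital_cstar_algebra)"
proof -
  have le: "norm (f a) \<le> norm a" if f: "cstar_automorphism f" for f and a :: 'a
  proof -
    have add: "\<And>a b. f (a + b) = f a + f b" and sc: "\<And>c a. f (c *\<^sub>C a) = c *\<^sub>C f a"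
      and mult: "\<And>a b. f (a * b) = f a * f b" and st: "\<And>a. f (star a) = star (f a)" and one: "f 1 = 1"
      using f by (auto simp: cstar_automorphism_def)
    have pos: "cstar_positive (f b)" if "cstar_positive b" for b
      using that by (auto simp: cstar_positive_def mult st)
    have diff: "f (a - b) = f a - f b" for a b using add[of "a - b" b] by simp
    let ?t = "norm (star a * a)"
    have "cstar_positive (f (?t *\<^sub>R 1 - star a * a))"
      by (intro pos cstar_positive_norm_diff) (auto simp: star_mult)
    also have "f (?t *\<^sub>R 1 - star a * a) = ?t *\<^sub>R 1 - f (star a * a)"
      by (simp add: diff sc one scaleC_of_real[symmetric])
    finally have "norm (f (star a * a)) \<le> norm (?t *\<^sub>R (1::'a))"
      by (intro cstar_positive_norm_mono pos cstar_positive_star_mult)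
    also have "\<dots> \<le> ?t" using norm_one_le[where 'a = 'a] by (simp add: mult_left_le)
    finally have "norm (f a) ^ 2 \<le> norm a ^ 2" by (simp add: mult st cstar_identity)
    then show ?thesis by (rule power2_le_imp_le) simp
  qed
  have "inv_into UNIV f (f a) = a" using f by (simp add: cstar_automorphism_def bij_def)
  then show ?thesis
    using le[OF f, of a] le[OF automorphism_inv[OF f], of "f a"] by simp
qed

lemma automorphism_bounded_linear:
  assumes f: "cstar_automorphism f"
  shows "bounded_linear (f :: 'a::unital_cstar_algebra \<Rightarrow> 'a)"
proof (rule bounded_linear_intro)
  show "f (x + y) = f x + f y" for x y using f by (simp add: cstar_automorphism_def)
  show "f (r *\<^sub>R x) = r *\<^sub>R f x" for r x
    using f by (simp add: cstar_automorphism_def scaleC_of_real[symmetric])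
  show "norm (f x) \<le> norm x * 1" for x by (simp add: automorphism_norm[OF f])
qed

lemma matrix_positive_star:
  assumes "matrix_positive n M" "i < n" "j < n"
  shows "star (M i j) = M j i"
proof -
  obtain N where "\<And>i j. i < n \<Longrightarrow> j < n \<Longrightarrow> M i j = (\<Sum>k<n. star (N k i) * N k j)"
    using assms(1) by (auto simp: matrix_positive_def)
  then show ?thesis using assms(2,3) by (simp add: star_sum star_mult)
qed

context twisted_dynamical_system
begin

abbreviation \<beta> :: "'g \<Rightarrow> 'a \<Rightarrow> 'a" where "\<beta> g \<equiv> inv_into UNIV (\<alpha> g)"

lemma \<alpha>_simps:
  "\<alpha> g (a + b) = \<alpha> g a + \<alpha> g b" "\<alpha> g (c *\<^sub>C a) = c *\<^sub>C \<alpha> g a"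
  "\<alpha> g (a * b) = \<alpha> g a * \<alpha> g b" "\<alpha> g (star a) = star (\<alpha> g a)" "\<alpha> g 1 = 1"
  using automorphism[of g] by (auto simp: cstar_automorphism_def)

lemma \<beta>_simps:
  "\<beta> g (a + b) = \<beta> g a + \<beta> g b" "\<beta> g (c *\<^sub>C a) = c *\<^sub>C \<beta> g a"
  "\<beta> g (a * b) = \<beta> g a * \<beta> g b" "\<beta> g (star a) = star (\<beta> g a)" "\<beta> g 1 = 1"
  using automorphism_inv[OF automorphism[of g]] by (auto simp: cstar_automorphism_def)

lemma \<alpha>_zero [simp]: "\<alpha> g 0 = 0"
  using \<alpha>_simps(1)[of g 0 0] by simp

lemma \<beta>_zero [simp]: "\<beta> g 0 = 0"
  using \<beta>_simps(1)[of g 0 0] by simp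

lemma \<alpha>_\<beta> [simp]: "\<alpha> g (\<beta> g a) = a"
  using automorphism[of g] by (simp add: cstar_automorphism_def bij_def surj_f_inv_f)

lemma \<beta>_\<alpha> [simp]: "\<beta> g (\<alpha> g a) = a"
  using automorphism[of g] by (simp add: cstar_automorphism_def bij_def)

lemma \<alpha>_diff: "\<alpha> g (a - b) = \<alpha> g a - \<alpha> g b"
  using \<alpha>_simps(1)[of g "a - b" b] by simp

lemma \<alpha>_unit [simp]: "\<alpha> 0 a = a"
proof -
  have "\<alpha> 0 (\<alpha> 0 a) = \<alpha> 0 a" using twisted_action[of 0 0 a] by (simp add: normalized_left)
  then show ?thesis by (metis \<beta>_\<alpha>)
qed

lemma \<beta>_unit [simp]: "\<beta> 0 a = a"
  by (metis \<alpha>_unit \<beta>_\<alpha>)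

lemma \<alpha>_norm [simp]: "norm (\<alpha> g a) = norm a"
  by (rule automorphism_norm[OF automorphism])

lemma unitary_simps [simp]:
  "star (\<sigma> g h) * \<sigma> g h = 1" "\<sigma> g h * star (\<sigma> g h) = 1"
  using unitary[of g h] by (auto simp: cstar_unitary_def)

lemma unitary_cancel [simp]:
  "star (\<sigma> g h) * (\<sigma> g h * a) = a" "\<sigma> g h * (star (\<sigma> g h) * a) = a"
  by (simp_all add: mult.assoc[symmetric])

lemma group_simps [simp]: "h + (- h + g) = g" "- h + (h + g) = (g::'g)"
  by (simp_all add: add.assoc[symmetric])

end

section \<open>The representation defined by positive definite maps\<close>

text \<open>
  A sequence of maps is treated at once so that linear combinations need no direct sums: the first
  component of an index \<open>(k, g, a)\<close> selects the map \<open>T k\<close>.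
\<close>

locale positive_definite_family = twisted_dynamical_system \<alpha> \<sigma>
  for \<alpha> :: "'g::group_add \<Rightarrow> 'a::unital_cstar_algebra \<Rightarrow> 'a" and \<sigma> +
  fixes T :: "nat \<Rightarrow> 'g \<Rightarrow> 'a \<Rightarrow> 'a"
  assumes positive_definite: "T k \<in> positive_definite_maps \<alpha> \<sigma>"
begin

text \<open>
  The inner product of \<open>\<rho>(a) v(g) \<xi>\<^sub>k\<close> and \<open>\<rho>(b) v(h) \<xi>\<^sub>l\<close>, forced by \<open>\<langle>\<xi>\<^sub>k, \<rho>(a) v(g) \<xi>\<^sub>k\<rangle> = T k g a\<close> and
  equivariance. Different maps \<open>T k\<close>, \<open>T l\<close> live on orthogonal summands.
\<close>

definition gns_kernel :: "nat \<times> 'g \<times> 'a \<Rightarrow> nat \<times> 'g \<times> 'a \<Rightarrow> 'a" where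
  "gns_kernel = (\<lambda>(k, g, a) (l, h, b). if k = l
     then \<alpha> g (T k (- g + h) (\<beta> g (star a * b * star (\<sigma> g (- g + h))))) * \<sigma> g (- g + h) else 0)"

lemma T_add: "T k g (a + b) = T k g a + T k g b" and T_scaleC: "T k g (c *\<^sub>C a) = c *\<^sub>C T k g a"
  using positive_definite[of k] by (auto simp: positive_definite_maps_def linear_maps_def)

lemma gns_kernel_matrix: "matrix_positive n (\<lambda>i j. gns_kernel (k, g i, a i) (k, g j, a j))"
  using positive_definite[of k] by (auto simp: positive_definite_maps_def gns_kernel_def)

lemma gns_kernel_star: "star (gns_kernel s t) = gns_kernel t s"
proof -
  obtain k g a l h b where st: "s = (k, g, a)" "t = (l, h, b)" by (metis prod_cases3)
  show ?thesis
  proof (cases "k = l")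
    case True
    then show ?thesis
      using matrix_positive_star[OF gns_kernel_matrix[of 2 k "\<lambda>i. if i = 0 then g else h" "\<lambda>i. if i = 0 then a else b"], of 0 1]
      by (simp add: st)
  qed (simp add: st gns_kernel_def)
qed

text \<open>
  The quadratic form splits into one form for each block \<open>m\<close>, with the coefficients outside the block
  set to zero; each of these is nonnegative by positive definiteness of \<open>T m\<close>.
\<close>

lemma gns_kernel_positive: "cstar_positive (comb_eval L (\<lambda>t. \<Sum>(s, a)\<leftarrow>L. gns_kernel t s * a))"
proof -
  define n where "n = length L"
  define S where "S i = fst (L ! i)" for i
  define a where "a i = snd (L ! i)" for i
  define k where "k i = fst (S i)" for i
  define I where "I = k ` {..<n}"
  have list_sum: "(\<Sum>(s, b)\<leftarrow>L. F s b) = (\<Sum>i<n. F (S i) (a i))" for F :: "_ \<Rightarrow> _ \<Rightarrow> 'a"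
    by (simp add: sum_list_sum_nth n_def S_def a_def case_prod_unfold atLeast0LessThan)
  have "comb_eval L (\<lambda>t. \<Sum>(s, a)\<leftarrow>L. gns_kernel t s * a) =
      (\<Sum>i<n. \<Sum>j<n. star (a i) * gns_kernel (S i) (S j) * a j)"
    by (simp add: comb_eval_def list_sum sum_distrib_left mult.assoc)
  also have "\<dots> = (\<Sum>i<n. \<Sum>j<n. \<Sum>m\<in>I. star (if k i = m then a i else 0) *
      gns_kernel (m, snd (S i)) (m, snd (S j)) * (if k j = m then a j else 0))"
  proof (intro sum.cong refl)
    fix i j assume ij: "i \<in> {..<n}" "j \<in> {..<n}"
    have S: "gns_kernel (S i) (S j) =
        (if k i = k j then gns_kernel (k i, snd (S i)) (k i, snd (S j)) else 0)"
      by (auto simp: gns_kernel_def case_prod_unfold k_def)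
    have "(\<Sum>m\<in>I. star (if k i = m then a i else 0) *
        gns_kernel (m, snd (S i)) (m, snd (S j)) * (if k j = m then a j else 0)) =
      (\<Sum>m\<in>I. if k i = m then star (a i) * gns_kernel (S i) (S j) * a j else 0)"
    proof (intro sum.cong refl)
      fix m
      show "star (if k i = m then a i else 0) * gns_kernel (m, snd (S i)) (m, snd (S j)) * (if k j = m then a j else 0) =
        (if k i = m then star (a i) * gns_kernel (S i) (S j) * a j else 0)"
        by (auto simp: S)
    qed
    also have "\<dots> = star (a i) * gns_kernel (S i) (S j) * a j"
      using ij by (simp add: I_def)
    finally show "star (a i) * gns_kernel (S i) (S j) * a j = (\<Sum>m\<in>I. star (if k i = m then a i else 0) *
        gns_kernel (m, snd (S i)) (m, snd (S j)) * (if k j = m then a j else 0))" by simp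
  qed
  also have "\<dots> = (\<Sum>m\<in>I. \<Sum>i<n. \<Sum>j<n. star (if k i = m then a i else 0) *
      gns_kernel (m, snd (S i)) (m, snd (S j)) * (if k j = m then a j else 0))"
    by (subst (2) sum.swap, subst sum.swap) (rule refl)
  also have "cstar_positive \<dots>"
  proof (rule cstar_positive_sum)
    fix m
    show "cstar_positive (\<Sum>i<n. \<Sum>j<n. star (if k i = m then a i else 0) *
      gns_kernel (m, snd (S i)) (m, snd (S j)) * (if k j = m then a j else 0))"
      using matrix_positiveD[OF gns_kernel_matrix[of n m "\<lambda>i. fst (snd (S i))" "\<lambda>i. snd (snd (S i))"],
          of "\<lambda>i. if k i = m then a i else 0"] by simp
  qed
  finally show ?thesis .
qed

sublocale positive_kernel gns_kernel
  by unfold_locales (rule gns_kernel_star gns_kernel_positive)+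

lemma gns_kernel_left: "gns_kernel (k, g, star c * a) (l, h, b) = gns_kernel (k, g, a) (l, h, c * b)"
  by (simp add: gns_kernel_def star_mult mult.assoc)

lemma gns_kernel_add_right: "gns_kernel s (l, h, a + b) = gns_kernel s (l, h, a) + gns_kernel s (l, h, b)"
  by (cases s) (simp add: gns_kernel_def algebra_simps \<alpha>_simps(1) \<beta>_simps(1) T_add)

lemma gns_kernel_scaleC_right: "gns_kernel s (l, h, c *\<^sub>C a) = c *\<^sub>C gns_kernel s (l, h, a)"
  by (cases s) (simp add: gns_kernel_def mult_scaleC_left mult_scaleC_right \<alpha>_simps(2) \<beta>_simps(2) T_scaleC)

text \<open>
  The kernel is equivariant under \<open>v(h)\<close>, which sends \<open>\<rho>(a) v(g) \<xi>\<close> to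
  \<open>\<rho>(\<alpha>\<^sub>h(a)) v(h) v(g) \<xi> = (\<rho>(\<alpha>\<^sub>h(a) \<sigma>(h, g)) v(h g) \<xi>) \<sigma>(h, g)\<^sup>*\<close>. With \<open>d = g\<^sup>-\<^sup>1 g'\<close>, both sides contain the
  same value of \<open>T k d\<close>, and the remaining factors agree by the cocycle identity for \<open>h, g, d\<close>.
\<close>

lemma gns_kernel_shift:
  "\<alpha> h (gns_kernel (k, g, a) (l, g', b)) =
   \<sigma> h g * gns_kernel (k, h + g, \<alpha> h a * \<sigma> h g) (l, h + g', \<alpha> h b * \<sigma> h g') * star (\<sigma> h g')"
proof (cases "k = l")
  case True
  define d where "d = - g + g'"
  define s where "s = \<sigma> h g"
  have g': "g' = g + d" and d': "- (h + g) + (h + g') = d"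
    by (simp_all add: d_def) (simp only: minus_add add.assoc group_simps)
  have s: "star s * s = 1" "s * star s = 1" by (simp_all add: s_def)
  have coc: "s * \<sigma> (h + g) d = \<alpha> h (\<sigma> g d) * \<sigma> h g'"
    using cocycle[of h g d] by (simp add: s_def g')
  have coc': "\<sigma> h g' * star (\<sigma> (h + g) d) = \<alpha> h (star (\<sigma> g d)) * s"
  proof -
    have "\<alpha> h (star (\<sigma> g d)) * s = \<alpha> h (star (\<sigma> g d)) * (s * \<sigma> (h + g) d) * star (\<sigma> (h + g) d)"
      by (simp add: mult.assoc)
    also have "\<dots> = \<alpha> h (star (\<sigma> g d) * \<sigma> g d) * \<sigma> h g' * star (\<sigma> (h + g) d)"
      by (simp only: coc \<alpha>_simps(3) mult.assoc)
    finally show ?thesis by (simp add: \<alpha>_simps)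
  qed
  have twist: "\<alpha> (h + g) x = star s * \<alpha> h (\<alpha> g x) * s" for x
    by (simp add: twisted_action s_def mult.assoc)
  define w where "w = \<beta> g (star a * b * star (\<sigma> g d))"
  have arg: "\<beta> (h + g) (star (\<alpha> h a * s) * (\<alpha> h b * \<sigma> h g') * star (\<sigma> (h + g) d)) = w"
  proof -
    have "star (\<alpha> h a * s) * (\<alpha> h b * \<sigma> h g') * star (\<sigma> (h + g) d) =
        star s * star (\<alpha> h a) * \<alpha> h b * (\<sigma> h g' * star (\<sigma> (h + g) d))"
      by (simp add: star_mult mult.assoc)
    also have "\<dots> = star s * \<alpha> h (star a * b * star (\<sigma> g d)) * s"
      unfolding coc' by (simp add: \<alpha>_simps mult.assoc)
    also have "\<dots> = \<alpha> (h + g) w" by (simp add: twist w_def)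
    finally show ?thesis by simp
  qed
  have "s * gns_kernel (k, h + g, \<alpha> h a * s) (l, h + g', \<alpha> h b * \<sigma> h g') * star (\<sigma> h g') =
      s * (\<alpha> (h + g) (T k d w) * \<sigma> (h + g) d) * star (\<sigma> h g')"
    using True arg by (simp add: gns_kernel_def d')
  also have "\<dots> = (s * star s) * \<alpha> h (\<alpha> g (T k d w)) * (s * \<sigma> (h + g) d) * star (\<sigma> h g')"
    by (simp add: twist mult.assoc)
  also have "\<dots> = \<alpha> h (\<alpha> g (T k d w) * \<sigma> g d)"
    unfolding coc s by (simp add: \<alpha>_simps mult.assoc)
  finally show ?thesis
    using True by (simp add: gns_kernel_def s_def w_def d_def)
qed (simp add: gns_kernel_def)

subsection \<open>The representation of the algebra\<close>

text \<open>
  \<open>\<rho>(c)\<close> in terms of inner products with the generators: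
  \<open>\<langle>\<rho>(a) v(g) \<xi>, \<rho>(c) f\<rangle> = \<langle>\<rho>(c\<^sup>*a) v(g) \<xi>, f\<rangle>\<close>. Its effect on combinations is \<open>rep_comb\<close>.
\<close>

definition gns_rep :: "'a \<Rightarrow> (nat \<times> 'g \<times> 'a \<Rightarrow> 'a) \<Rightarrow> nat \<times> 'g \<times> 'a \<Rightarrow> 'a" where
  "gns_rep c f = (\<lambda>(k, g, a). f (k, g, star c * a))"

definition rep_comb :: "'a \<Rightarrow> ((nat \<times> 'g \<times> 'a) \<times> 'a) list \<Rightarrow> ((nat \<times> 'g \<times> 'a) \<times> 'a) list" where
  "rep_comb c = map (\<lambda>((k, g, a), b). ((k, g, c * a), b))"

lemma comb_eval_rep_comb: "comb_eval (rep_comb c L) f = comb_eval L (gns_rep (star c) f)"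
  by (induction L) (auto simp: rep_comb_def gns_rep_def)

lemma gns_rep_comb: "gns_rep c (comb L) = comb (rep_comb c L)"
proof (induction L)
  case (Cons p L)
  then show ?case
    by (cases p) (auto simp: comb_Cons rep_comb_def gns_rep_def fun_eq_iff gns_kernel_left)
qed (simp add: comb_Nil rep_comb_def gns_rep_def fun_eq_iff)

lemma rep_comb_mult: "rep_comb c (rep_comb d L) = rep_comb (c * d) L"
  by (auto simp: rep_comb_def mult.assoc)

lemma comb_rep_add: "comb (rep_comb (c + d) L) = comb (rep_comb c L) + comb (rep_comb d L)"
  by (induction L)
    (auto simp: comb_Cons comb_Nil rep_comb_def fun_eq_iff distrib_right gns_kernel_add_right)

lemma comb_rep_scaleC: "comb (rep_comb (z *\<^sub>C c) L) = (\<lambda>s. z *\<^sub>C comb (rep_comb c L) s)"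
  by (induction L)
    (auto simp: comb_Cons comb_Nil rep_comb_def fun_eq_iff mult_scaleC_left gns_kernel_scaleC_right scaleC_add_right)

text \<open>
  Let \<open>Q d = \<langle>L, \<rho>(d) L\<rangle>\<close>, which is linear in \<open>d\<close> and nonnegative at \<open>d\<^sup>*d\<close>. Since \<open>\<parallel>c\<parallel>\<^sup>2 - c\<^sup>*c\<close> is of
  this form, \<open>Q(c\<^sup>*c) \<le> \<parallel>c\<parallel>\<^sup>2 Q(1)\<close>.
\<close>

lemma comb_norm_rep: "comb_norm (rep_comb c L) \<le> norm c * comb_norm L"
proof -
  define Q where "Q d = comb_eval L (comb (rep_comb d L))" for d
  have Q: "comb_eval (rep_comb d L) (comb (rep_comb d L)) = Q (star d * d)" for d
    by (simp add: comb_eval_rep_comb gns_rep_comb rep_comb_mult Q_def)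
  have Q_add: "Q (c + d) = Q c + Q d" for c d
    by (simp add: Q_def comb_rep_add comb_eval_add)
  have Q_scale: "Q (z *\<^sub>C d) = z *\<^sub>C Q d" for z d
    by (simp add: Q_def comb_rep_scaleC comb_eval_scaleC)
  have "rep_comb 1 L = L" by (induction L) (auto simp: rep_comb_def)
  then have Q1: "Q 1 = comb_eval L (comb L)" by (simp add: Q_def)
  define t where "t = norm c ^ 2"
  have "cstar_positive (t *\<^sub>R 1 - star c * c)"
    by (intro cstar_positive_norm_diff) (auto simp: star_mult cstar_identity t_def)
  then obtain d where d: "t *\<^sub>R 1 - star c * c = star d * d" by (auto simp: cstar_positive_def)
  then have "complex_of_real t *\<^sub>C 1 = star d * d + star c * c"
    by (simp add: scaleC_of_real algebra_simps)
  then have "complex_of_real t *\<^sub>C Q 1 = Q (star d * d) + Q (star c * c)"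
    by (simp flip: Q_scale Q_add)
  then have "t *\<^sub>R Q 1 - Q (star c * c) = Q (star d * d)" by (simp add: scaleC_of_real)
  then have "norm (Q (star c * c)) \<le> norm (t *\<^sub>R Q 1)"
    by (intro cstar_positive_norm_mono) (auto simp flip: Q intro: comb_eval_comb_positive)
  then have "comb_norm (rep_comb c L) ^ 2 \<le> (norm c * comb_norm L) ^ 2"
    by (simp add: comb_norm_square Q Q1 power_mult_distrib t_def)
  then show ?thesis by (rule power2_le_imp_le) simp
qed

lemma gns_rep_bounded:
  assumes "bounded_by f r"
  shows "bounded_by (gns_rep c f) (norm c * \<bar>r\<bar>)"
  unfolding bounded_by_def
proof
  fix L
  have "norm (comb_eval L (gns_rep c f)) \<le> r * comb_norm (rep_comb (star c) L)"
    using assms[unfolded bounded_by_def, THEN spec, of "rep_comb (star c) L"]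
    by (simp add: comb_eval_rep_comb)
  also have "\<dots> \<le> \<bar>r\<bar> * (norm c * comb_norm L)"
    using comb_norm_rep[of "star c" L] by (intro mult_mono) auto
  finally show "norm (comb_eval L (gns_rep c f)) \<le> norm c * \<bar>r\<bar> * comb_norm L" by (simp add: mult_ac)
qed

lemma gns_rep_approx: "approx f L \<Longrightarrow> approx (gns_rep c f) (\<lambda>n. rep_comb c (L n))"
  by (rule approx_image[where C = "norm c"])
    (auto simp: gns_rep_comb gns_rep_bounded, auto simp: gns_rep_def fun_eq_iff)

lemma gns_rep_space: "f \<in> kernel_space \<Longrightarrow> gns_rep c f \<in> kernel_space"
  unfolding kernel_space_def using gns_rep_approx by blast

lemma gns_rep_adjoint:
  assumes "f \<in> kernel_space" "g \<in> kernel_space"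
  shows "kernel_inner (gns_rep c f) g = kernel_inner f (gns_rep (star c) g)"
proof -
  obtain L where L: "approx f L" using assms(1) by (auto simp: kernel_space_def)
  show ?thesis
    by (rule kernel_inner_eqI[OF gns_rep_approx[OF L] assms(2)])
      (simp add: comb_eval_rep_comb kernel_inner_tendsto L gns_rep_space assms)
qed

lemma kernel_space_additive: "f (k, g, a + b) = f (k, g, a) + f (k, g, b)" if "f \<in> kernel_space"
proof -
  let ?L = "[((k, g, a + b), 1), ((k, g, a), - 1), ((k, g, b), - 1)]"
  have "gns_kernel (k, g, a + b) s = gns_kernel (k, g, a) s + gns_kernel (k, g, b) s" for s
    using gns_kernel_add_right[of s k g a b, THEN arg_cong[of _ _ star]] by (simp only: star_add gns_kernel_star)
  then have "comb M (k, g, a + b) = comb M (k, g, a) + comb M (k, g, b)" for M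
    by (induction M) (auto simp: comb_Nil comb_Cons distrib_right)
  then have "comb_eval ?L (comb M) = 0" for M by simp
  from comb_eval_null[OF that this] show ?thesis by (simp add: algebra_simps)
qed

lemma kernel_space_conj_homogeneous: "f (k, g, c *\<^sub>C a) = cnj c *\<^sub>C f (k, g, a)" if "f \<in> kernel_space"
proof -
  let ?L = "[((k, g, c *\<^sub>C a), 1), ((k, g, a), - (c *\<^sub>C 1))]"
  have "gns_kernel (k, g, c *\<^sub>C a) s = cnj c *\<^sub>C gns_kernel (k, g, a) s" for s
    using gns_kernel_scaleC_right[of s k g c a, THEN arg_cong[of _ _ star]] by (simp only: star_scaleC gns_kernel_star)
  then have "comb M (k, g, c *\<^sub>C a) = cnj c *\<^sub>C comb M (k, g, a)" for M
    by (induction M) (auto simp: comb_Nil comb_Cons mult_scaleC_left scaleC_add_right)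
  then have "comb_eval ?L (comb M) = 0" for M by (simp add: star_scaleC mult_scaleC_left)
  from comb_eval_null[OF that this] show ?thesis by (simp add: star_scaleC mult_scaleC_left)
qed

lemma star_representation_gns: "star_representation kernel_module gns_rep"
proof -
  have adj: "is_adjoint kernel_module (gns_rep a) (gns_rep (star a))" for a
    by (simp add: is_adjoint_def gns_rep_space gns_rep_adjoint)
  then have "adjointable kernel_module (gns_rep a)" for a by (auto simp: adjointable_def)
  with adj show ?thesis
    by (auto simp: star_representation_def gns_rep_def fun_eq_iff star_add star_scaleC star_mult
        distrib_right mult_scaleC_left kernel_space_additive kernel_space_conj_homogeneous mult.assoc)
qed

subsection \<open>The action of the group\<close>

text \<open>
  \<open>v(h)\<close> in terms of inner products with the generators:
  \<open>\<langle>\<delta>\<^sub>s, v(h) f\<rangle> = \<alpha>\<^sub>h(\<langle>v(h)\<^sup>-\<^sup>1 \<delta>\<^sub>s, f\<rangle>)\<close>. The map \<open>gns_unshift\<close> is its inverse, and \<open>shift_comb\<close>, \<open>unshift_comb\<close> are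
  their effects on combinations.
\<close>

definition gns_shift :: "'g \<Rightarrow> (nat \<times> 'g \<times> 'a \<Rightarrow> 'a) \<Rightarrow> nat \<times> 'g \<times> 'a \<Rightarrow> 'a" where
  "gns_shift h f = (\<lambda>(k, g, a). star (\<sigma> h (- h + g)) *
     \<alpha> h (f (k, - h + g, \<beta> h (a * star (\<sigma> h (- h + g))))))"

definition gns_unshift :: "'g \<Rightarrow> (nat \<times> 'g \<times> 'a \<Rightarrow> 'a) \<Rightarrow> nat \<times> 'g \<times> 'a \<Rightarrow> 'a" where
  "gns_unshift h f = (\<lambda>(k, g, a). \<beta> h (\<sigma> h g * f (k, h + g, \<alpha> h a * \<sigma> h g)))"

definition shift_comb :: "'g \<Rightarrow> ((nat \<times> 'g \<times> 'a) \<times> 'a) list \<Rightarrow> ((nat \<times> 'g \<times> 'a) \<times> 'a) list" where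
  "shift_comb h = map (\<lambda>((k, g, a), b). ((k, h + g, \<alpha> h a * \<sigma> h g), star (\<sigma> h g) * \<alpha> h b))"

definition unshift_comb :: "'g \<Rightarrow> ((nat \<times> 'g \<times> 'a) \<times> 'a) list \<Rightarrow> ((nat \<times> 'g \<times> 'a) \<times> 'a) list" where
  "unshift_comb h = map (\<lambda>((k, g, a), b).
     ((k, - h + g, \<beta> h (a * star (\<sigma> h (- h + g)))), \<beta> h (\<sigma> h (- h + g) * b)))"

lemma comb_eval_shift: "comb_eval L (gns_shift h f) = \<alpha> h (comb_eval (unshift_comb h L) f)"
  by (induction L)
    (auto simp: gns_shift_def unshift_comb_def \<alpha>_simps star_mult mult.assoc)

lemma comb_eval_unshift: "\<alpha> h (comb_eval L (gns_unshift h f)) = comb_eval (shift_comb h L) f"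
  by (induction L)
    (auto simp: gns_unshift_def shift_comb_def \<alpha>_simps star_mult mult.assoc)

lemma gns_shift_unshift: "gns_shift h (gns_unshift h f) = f"
  by (simp add: gns_shift_def gns_unshift_def fun_eq_iff mult.assoc)

lemma gns_unshift_shift: "gns_unshift h (gns_shift h f) = f"
  by (simp add: gns_shift_def gns_unshift_def fun_eq_iff mult.assoc)

lemma shift_unshift_comb: "shift_comb h (unshift_comb h L) = L"
  by (induction L) (auto simp: shift_comb_def unshift_comb_def mult.assoc)

text \<open>
  By \<open>gns_kernel_shift\<close> for each generator. Since \<open>gns_unshift\<close> and \<open>gns_shift\<close> are inverse to each
  other, this determines both on all combinations.
\<close>

lemma gns_unshift_shift_comb: "gns_unshift h (comb (shift_comb h L)) = comb L"
proof (induction L)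
  case Nil
  show ?case by (simp add: shift_comb_def comb_Nil gns_unshift_def fun_eq_iff)
next
  case (Cons p L)
  obtain l g' b c where p: "p = ((l, g', b), c)" by (metis prod_cases3 surj_pair)
  define q where "q = (l, h + g', \<alpha> h b * \<sigma> h g')"
  have add: "gns_unshift h (F + G) = gns_unshift h F + gns_unshift h G" for F G
    by (simp add: gns_unshift_def fun_eq_iff distrib_left \<beta>_simps(1))
  have single: "gns_unshift h (\<lambda>t. gns_kernel t q * (star (\<sigma> h g') * \<alpha> h c)) =
      (\<lambda>t. gns_kernel t (l, g', b) * c)"
  proof
    fix t :: "nat \<times> 'g \<times> 'a"
    obtain k g a where t: "t = (k, g, a)" by (metis prod_cases3)
    have "\<sigma> h g * (gns_kernel (k, h + g, \<alpha> h a * \<sigma> h g) q * (star (\<sigma> h g') * \<alpha> h c)) =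
        \<alpha> h (gns_kernel (k, g, a) (l, g', b) * c)"
      unfolding \<alpha>_simps(3) gns_kernel_shift q_def by (simp only: mult.assoc)
    then show "gns_unshift h (\<lambda>t. gns_kernel t q * (star (\<sigma> h g') * \<alpha> h c)) t =
        gns_kernel t (l, g', b) * c"
      by (simp add: t gns_unshift_def)
  qed
  have "shift_comb h (p # L) = (q, star (\<sigma> h g') * \<alpha> h c) # shift_comb h L"
    by (simp add: shift_comb_def p q_def)
  then show ?case
    by (simp only: comb_Cons add single Cons p)
qed

lemma gns_shift_comb: "gns_shift h (comb L) = comb (shift_comb h L)"
  by (metis gns_unshift_shift_comb gns_shift_unshift)

lemma gns_unshift_comb: "gns_unshift h (comb L) = comb (unshift_comb h L)"
  by (metis gns_unshift_shift_comb shift_unshift_comb)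

lemma comb_norm_shift: "comb_norm (shift_comb h L) = comb_norm L"
  unfolding comb_norm_def comb_eval_unshift[symmetric] gns_unshift_shift_comb by simp

lemma comb_norm_unshift: "comb_norm (unshift_comb h L) = comb_norm L"
  using comb_norm_shift[of h "unshift_comb h L"] by (simp add: shift_unshift_comb)

lemma gns_shift_bounded: "bounded_by f r \<Longrightarrow> bounded_by (gns_shift h f) r"
  unfolding bounded_by_def comb_eval_shift \<alpha>_norm by (metis comb_norm_unshift)

lemma gns_unshift_bounded: "bounded_by f r \<Longrightarrow> bounded_by (gns_unshift h f) r"
  unfolding bounded_by_def
  by (metis \<alpha>_norm comb_eval_unshift comb_norm_shift)

lemma gns_shift_approx: "approx f L \<Longrightarrow> approx (gns_shift h f) (\<lambda>n. shift_comb h (L n))"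
  by (rule approx_image[where C = 1])
    (auto simp: gns_shift_comb intro: bounded_by_mono gns_shift_bounded,
     auto simp: gns_shift_def fun_eq_iff \<alpha>_diff algebra_simps)

lemma gns_unshift_approx: "approx f L \<Longrightarrow> approx (gns_unshift h f) (\<lambda>n. unshift_comb h (L n))"
  by (rule approx_image[where C = 1])
    (auto simp: gns_unshift_comb intro: bounded_by_mono gns_unshift_bounded,
     auto simp: gns_unshift_def fun_eq_iff linear_diff[OF bounded_linear.linear[OF
        automorphism_bounded_linear[OF automorphism_inv[OF automorphism]]]] right_diff_distrib)

lemma gns_shift_space: "f \<in> kernel_space \<Longrightarrow> gns_shift h f \<in> kernel_space"
  unfolding kernel_space_def using gns_shift_approx by blast

lemma gns_unshift_space: "f \<in> kernel_space \<Longrightarrow> gns_unshift h f \<in> kernel_space"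
  unfolding kernel_space_def using gns_unshift_approx by blast

lemma gns_shift_inner:
  assumes "f \<in> kernel_space" "g \<in> kernel_space"
  shows "kernel_inner (gns_shift h f) (gns_shift h g) = \<alpha> h (kernel_inner f g)"
proof -
  obtain L where L: "approx f L" using assms(1) by (auto simp: kernel_space_def)
  show ?thesis
  proof (rule kernel_inner_eqI[OF gns_shift_approx[OF L] gns_shift_space[OF assms(2)]])
    show "(\<lambda>n. comb_eval (shift_comb h (L n)) (gns_shift h g)) \<longlonglongrightarrow> \<alpha> h (kernel_inner f g)"
      unfolding comb_eval_unshift[symmetric] gns_unshift_shift
      by (intro bounded_linear.tendsto[OF automorphism_bounded_linear[OF automorphism]] kernel_inner_tendsto L assms)
  qed
qed

text \<open>
  The identity \<open>v(g) v(h) = ad(\<sigma>(g, h)) v(g h)\<close>, pointwise. For \<open>u = g h m\<close> it amounts to the cocycle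
  identity for \<open>g, h, m\<close>, used once for the argument of \<open>f\<close> and once for the factor in front.
\<close>

lemma gns_shift_shift:
  "gns_shift g (gns_shift h f) (k, u, t) = gns_rep (\<sigma> g h) (gns_shift (g + h) f) (k, u, t) * star (\<sigma> g h)"
proof -
  define m where "m = - h + (- g + u)"
  have "- (g + h) + u = m" by (simp only: m_def minus_add add.assoc)
  moreover have "- g + u = h + m" by (simp add: m_def)
  ultimately have u: "- g + u = h + m" "- h + (h + m) = m" "- (g + h) + u = m" by simp_all
  define s where "s = \<sigma> g h"
  have s: "star s * s = 1" by (simp add: s_def)
  have coc: "\<alpha> g (\<sigma> h m) * \<sigma> g (h + m) = s * \<sigma> (g + h) m"
    using cocycle[of g h m] by (simp add: s_def)
  have coc': "star (\<sigma> g (h + m)) * star (\<alpha> g (\<sigma> h m)) = star (\<sigma> (g + h) m) * star s"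
    using coc[THEN arg_cong[of _ _ star]] by (simp add: star_mult)
  have twist: "\<alpha> g (\<alpha> h x) = s * \<alpha> (g + h) x * star s" for x
    by (simp add: twisted_action s_def)
  have arg: "\<beta> h (\<beta> g (t * star (\<sigma> g (h + m))) * star (\<sigma> h m)) =
      \<beta> (g + h) (star s * t * star (\<sigma> (g + h) m))" (is "?x = ?y")
  proof -
    have "\<alpha> g (\<alpha> h ?x) = t * (star (\<sigma> g (h + m)) * star (\<alpha> g (\<sigma> h m)))"
      by (simp add: \<alpha>_simps mult.assoc)
    also have "\<dots> = s * (star s * t * star (\<sigma> (g + h) m)) * star s"
      unfolding coc' by (simp add: s_def mult.assoc)
    also have "\<dots> = \<alpha> g (\<alpha> h ?y)" by (simp add: twist)
    finally show ?thesis by (metis \<beta>_\<alpha>)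
  qed
  have "gns_shift g (gns_shift h f) (k, u, t) = star (\<sigma> g (h + m)) * (star (\<alpha> g (\<sigma> h m)) * \<alpha> g (\<alpha> h (f (k, m, ?x))))"
    by (simp add: gns_shift_def u \<alpha>_simps)
  also have "\<dots> = (star (\<sigma> g (h + m)) * star (\<alpha> g (\<sigma> h m))) * \<alpha> g (\<alpha> h (f (k, m, ?y)))"
    by (simp only: arg mult.assoc)
  also have "\<dots> = star (\<sigma> (g + h) m) * \<alpha> (g + h) (f (k, m, ?y)) * star s"
    unfolding coc' twist by (simp add: s_def mult.assoc)
  finally show ?thesis
    by (simp add: gns_shift_def gns_rep_def u s_def mult.assoc)
qed

lemma equivariant_representation_gns:
  "equivariant_representation \<alpha> \<sigma> kernel_module gns_rep gns_shift"
proof -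
  have bij: "bij_betw (gns_shift g) kernel_space kernel_space" for g
    by (rule bij_betwI[of _ _ _ "gns_unshift g"])
      (auto simp: gns_shift_space gns_unshift_space gns_shift_unshift gns_unshift_shift)
  have shift_linear: "gns_shift g (x + y) = gns_shift g x + gns_shift g y"
      "gns_shift g (\<lambda>s. c *\<^sub>C x s) = (\<lambda>s. c *\<^sub>C gns_shift g x s)" for g x y c
    by (auto simp: gns_shift_def fun_eq_iff \<alpha>_simps distrib_left mult_scaleC_right)
  have shift_act: "gns_shift g (\<lambda>s. x s * a) = (\<lambda>s. gns_shift g x s * \<alpha> g a)" for g x a
    by (auto simp: gns_shift_def fun_eq_iff \<alpha>_simps mult.assoc)
  have bounded: "bounded_invertible kernel_module (gns_shift g)" for g
    unfolding bounded_invertible_def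
    by (auto simp: bij hnorm_def gns_shift_inner shift_linear intro!: exI[of _ 1])
  have covariant: "gns_rep (\<alpha> g a) x = gns_shift g (gns_rep a (inv_into kernel_space (gns_shift g) x))"
    if x: "x \<in> kernel_space" for g a x
  proof -
    have "inv_into kernel_space (gns_shift g) x = gns_unshift g x"
      using x bij[of g] by (intro inv_into_f_eq) (auto simp: bij_betw_def gns_unshift_space gns_shift_unshift)
    moreover have "gns_rep (\<alpha> g a) (gns_shift g y) = gns_shift g (gns_rep a y)" for y
      by (simp add: gns_rep_def gns_shift_def fun_eq_iff \<beta>_simps mult.assoc)
    ultimately show ?thesis by (metis gns_shift_unshift)
  qed
  show ?thesis
    unfolding equivariant_representation_def kernel_module_simps
    by (auto simp: star_representation_gns bounded covariant gns_shift_inner shift_act ad_rep_def)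
      (auto simp: fun_eq_iff gns_shift_shift)
qed

text \<open>
  The indices \<open>(k, 0, 1)\<close> are those of the cyclic vectors \<open>\<xi>\<^sub>k\<close>. Orthogonality of the summands leaves
  only the diagonal terms \<open>\<langle>\<xi>\<^sub>k, \<rho>(a) v(g) \<xi>\<^sub>k\<rangle> c\<^sub>k\<close>.
\<close>

lemma combination_is_coefficient:
  fixes m :: nat and c :: "nat \<Rightarrow> complex"
  defines "x \<equiv> comb (map (\<lambda>k. ((k, 0, 1), 1)) [0..<m])"
    and "y \<equiv> comb (map (\<lambda>k. ((k, 0, 1), c k *\<^sub>C 1)) [0..<m])"
  shows "coefficient kernel_module gns_rep gns_shift x y g a = (\<Sum>k<m. c k *\<^sub>C T k g a)"
proof -
  have K: "gns_kernel (k, 0, 1) (l, g, a) = (if k = l then T k g a else 0)" for k l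
    by (simp add: gns_kernel_def normalized_left)
  have "gns_rep a (gns_shift g y) = comb (map (\<lambda>k. ((k, g, a), c k *\<^sub>C 1)) [0..<m])"
    by (simp add: y_def gns_shift_comb gns_rep_comb shift_comb_def rep_comb_def o_def normalized_right \<alpha>_simps)
  then have "coefficient kernel_module gns_rep gns_shift x y g a =
      comb_eval (map (\<lambda>k. ((k, 0, 1), 1)) [0..<m]) (comb (map (\<lambda>k. ((k, g, a), c k *\<^sub>C 1)) [0..<m]))"
    by (simp add: coefficient_def x_def kernel_inner_comb comb_in_kernel_space)
  also have "\<dots> = (\<Sum>k<m. \<Sum>l<m. (if k = l then c k *\<^sub>C T k g a else 0))"
    by (simp add: comb_eval_def comb_def o_def K interv_sum_list_conv_sum_set_nat atLeast0LessThan
        mult_scaleC_right if_distrib[of "\<lambda>x. _ *\<^sub>C x"] cong: if_cong)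
  finally show ?thesis by simp
qed

end

lemma zero_positive_definite:
  assumes "twisted_dynamical_system \<alpha> \<sigma>"
  shows "0 \<in> positive_definite_maps \<alpha> \<sigma>"
proof -
  interpret twisted_dynamical_system \<alpha> \<sigma> by fact
  show ?thesis
    by (auto simp: positive_definite_maps_def linear_maps_def matrix_positive_def intro!: exI[of _ "\<lambda>_ _. 0"])
qed

lemma span_subset_coefficient_maps:
  fixes \<alpha> :: "'g::group_add \<Rightarrow> 'a::unital_cstar_algebra \<Rightarrow> 'a"
  assumes tds: "twisted_dynamical_system \<alpha> \<sigma>"
  shows "complex_span (positive_definite_maps \<alpha> \<sigma>) \<subseteq> coefficient_maps TYPE(('g, 'a) universe) \<alpha> \<sigma>"
proof
  interpret V: vector_space "map_scaleC :: complex \<Rightarrow> ('g \<Rightarrow> 'a \<Rightarrow> 'a) \<Rightarrow> _"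
    by (rule vector_space_map_scaleC)
  fix S assume "S \<in> complex_span (positive_definite_maps \<alpha> \<sigma>)"
  then obtain A r where A: "finite A" "A \<subseteq> positive_definite_maps \<alpha> \<sigma>"
    and S: "S = (\<Sum>U\<in>A. map_scaleC (r U) U)"
    unfolding complex_span_def V.span_explicit by auto
  obtain e where e: "bij_betw e {..<card A} A"
    using ex_bij_betw_nat_finite[OF A(1)] by (auto simp: atLeast0LessThan)
  \<comment> \<open>The sequence is padded by the positive definite map \<open>0\<close>.\<close>
  define T where "T k = (if k < card A then e k else 0)" for k
  have "T k \<in> positive_definite_maps \<alpha> \<sigma>" for k
    using A(2) bij_betwE[OF e] zero_positive_definite[OF tds] by (auto simp: T_def)
  then interpret positive_definite_family \<alpha> \<sigma> T
    using tds by (intro positive_definite_family.intro positive_definite_family_axioms.intro)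
  have sum_apply: "(\<Sum>U\<in>B. F U) g a = (\<Sum>U\<in>B. F U g a)" for B :: "('g \<Rightarrow> 'a \<Rightarrow> 'a) set" and g a
    and F :: "_ \<Rightarrow> 'g \<Rightarrow> 'a \<Rightarrow> 'a"
    by (induction B rule: infinite_finite_induct) auto
  let ?x = "comb (map (\<lambda>k. ((k, 0, 1), 1)) [0..<card A])"
  let ?y = "comb (map (\<lambda>k. ((k, 0, 1), r (e k) *\<^sub>C 1)) [0..<card A])"
  have "S g a = coefficient kernel_module gns_rep gns_shift ?x ?y g a" for g a
  proof -
    have "S g a = (\<Sum>U\<in>A. r U *\<^sub>C U g a)" by (simp add: S sum_apply map_scaleC_def)
    also have "\<dots> = (\<Sum>k<card A. r (e k) *\<^sub>C e k g a)"
      by (rule sum.reindex_bij_betw[OF e, symmetric])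
    also have "\<dots> = (\<Sum>k<card A. r (e k) *\<^sub>C T k g a)" by (simp add: T_def)
    finally show ?thesis by (simp only: combination_is_coefficient)
  qed
  then have "S = coefficient kernel_module gns_rep gns_shift ?x ?y" by blast
  moreover have "?x \<in> carrier kernel_module" "?y \<in> carrier kernel_module"
    by (simp_all add: comb_in_kernel_space)
  ultimately show "S \<in> coefficient_maps TYPE(('g, 'a) universe) \<alpha> \<sigma>"
    unfolding coefficient_maps_def
    using hilbert_module_kernel_module equivariant_representation_gns by blast
qed

theorem corollary4p21:
  fixes \<alpha> :: "'g::group_add \<Rightarrow> 'a::unital_cstar_algebra \<Rightarrow> 'a"
    and \<sigma> :: "'g \<Rightarrow> 'g \<Rightarrow> 'a"
  assumes "twisted_dynamical_system \<alpha> \<sigma>"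
  shows "coefficient_maps TYPE(('g, 'a) universe) \<alpha> \<sigma> = complex_span (positive_definite_maps \<alpha> \<sigma>) \<and>
    coefficient_maps TYPE('x) \<alpha> \<sigma> \<subseteq> complex_span (positive_definite_maps \<alpha> \<sigma>)"
  by (intro conjI subset_antisym coefficient_maps_subset_span[OF assms]
      span_subset_coefficient_maps[OF assms])

end
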